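(* Let $K\ge1$. On $\mathbb C^{2K+2}\times\mathbb C^\times$ with coordinates $(s_1,\dots,s_{2K+2},\lambda)$ consider the Poisson bracket $$\{s_j,s_l\}_{FN}=\delta_{j,l-1}-\frac{\delta_{j,1}\delta_{l,2K+2}}{\lambda^2}+(-1)^{j-l+1}s_js_l\quad(j<l),\qquad\{s_j,\lambda\}_{FN}=(-1)^js_j\lambda .$$ Let $$F=F_K=\begin{pmatrix}1&s_1\\ 0&1\end{pmatrix}\begin{pmatrix}1&0\\ s_2&1\end{pmatrix}\cdots\begin{pmatrix}1&s_{2K+1}\\ 0&1\end{pmatrix}\begin{pmatrix}1&0\\ s_{2K+2}&1\end{pmatrix}\begin{pmatrix}\lambda&0\\ 0&\lambda^{-1}\end{pmatrix}$$ and $$\sigma_3=\begin{pmatrix}1&0\\ 0&-1\end{pmatrix},\quad\sigma_+=\begin{pmatrix}0&1\\ 0&0\end{pmatrix},\quad\sigma_-=\begin{pmatrix}0&0\\ 1&0\end{pmatrix}.$$ (1) The matrix $F$ satisfies (brackets taken entrywise) \begin{align*} \{s_1,F\}_{FN}&=\frac{s_1}2[\sigma_3,F]+[\sigma_-,F],\\ \{s_{2K+2},F\}_{FN}&=\frac{s_{2K+2}}2[F,\sigma_3]+\frac1{\lambda^2}[\sigma_+,F],\\ \{s_\ell,F\}_{FN}&=(-1)^\ell\,\frac{s_\ell}2[F,\sigma_3],\qquad2\le\ell\le2K+1,\\ \{\lambda,F\}_{FN}&=\frac\lambda2[\sigma_3,F]. \end{align*} (2) The unique Casimir function of the bracket $\{\cdot,\cdot\}_{FN}$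 (up to functional dependence) is $\mathfrak C=\mathrm{Tr}(F)$. (3) The subvariety $\mathfrak S_K=\{F_K=\mathbf 1\}$ is a Poisson subvariety.
   Context: A Casimir function is a function whose bracket with every function vanishes. A Poisson subvariety is a subvariety whose defining ideal (here, generated by the entries of $F-\mathbf 1$) is closed under bracketing with arbitrary regular functions. $[\cdot,\cdot]$ denotes the matrix commutator. *)

theory Defs
  imports "HOL-Analysis.Analysis"
begin

text \<open>
  A point is a pair \<open>(x, \<lambda>)\<close>, where \<open>x\<close> is a vector over a finite index type \<open>'n\<close>.  The coordinates
  are labelled by an enumeration \<open>e\<close> of \<open>'n\<close>, assumed to be a bijection from \<open>{1..2*K+2}\<close>
  onto \<open>'n\<close>: the coordinate \<open>s\<^sub>j\<close> is the component of \<open>x\<close> at \<open>e j\<close>.  Functions are total in HOL;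
  only their values on \<open>phase_space\<close> matter.
\<close>

type_synonym 'n phase = "(complex ^ 'n) \<times> complex"

definition phase_space :: "('n::finite) phase set" where
  "phase_space = {p. snd p \<noteq> 0}"

definition coord_s :: "(nat \<Rightarrow> 'n::finite) \<Rightarrow> nat \<Rightarrow> 'n phase \<Rightarrow> complex" where
  "coord_s e j p = fst p $ e j"

definition coord_lam :: "('n::finite) phase \<Rightarrow> complex" where
  "coord_lam p = snd p"

definition partial_s :: "(nat \<Rightarrow> 'n::finite) \<Rightarrow> nat \<Rightarrow> ('n phase \<Rightarrow> complex) \<Rightarrow> 'n phase \<Rightarrow> complex" where
  "partial_s e j f p = deriv (\<lambda>z. f (\<chi> i. if i = e j then z else fst p $ i, snd p)) (coord_s e j p)"

definition partial_lam :: "(('n::finite) phase \<Rightarrow> complex) \<Rightarrow> 'n phase \<Rightarrow> complex" where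
  "partial_lam f p = deriv (\<lambda>z. f (fst p, z)) (coord_lam p)"

definition fn_ss_upper :: "nat \<Rightarrow> (nat \<Rightarrow> 'n::finite) \<Rightarrow> nat \<Rightarrow> nat \<Rightarrow> 'n phase \<Rightarrow> complex" where
  "fn_ss_upper K e j l p =
     of_bool (j + 1 = l) - of_bool (j = 1 \<and> l = 2*K+2) / (coord_lam p)\<^sup>2
     + (-1) powi (int j - int l + 1) * coord_s e j p * coord_s e l p"

definition fn_ss :: "nat \<Rightarrow> (nat \<Rightarrow> 'n::finite) \<Rightarrow> nat \<Rightarrow> nat \<Rightarrow> 'n phase \<Rightarrow> complex" where
  "fn_ss K e j l p =
     (if j < l then fn_ss_upper K e j l p else if l < j then - fn_ss_upper K e l j p else 0)"

definition fn_slam :: "(nat \<Rightarrow> 'n::finite) \<Rightarrow> nat \<Rightarrow> 'n phase \<Rightarrow> complex" where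
  "fn_slam e j p = (-1) ^ j * coord_s e j p * coord_lam p"

text \<open>The biderivation determined by the brackets of the coordinate functions.\<close>

definition fn_bracket ::
  "nat \<Rightarrow> (nat \<Rightarrow> 'n::finite) \<Rightarrow> ('n phase \<Rightarrow> complex) \<Rightarrow> ('n phase \<Rightarrow> complex) \<Rightarrow> 'n phase \<Rightarrow> complex"
  where
  "fn_bracket K e f g p =
     (\<Sum>j=1..2*K+2. \<Sum>l=1..2*K+2. fn_ss K e j l p * partial_s e j f p * partial_s e l g p)
     + (\<Sum>j=1..2*K+2. fn_slam e j p *
          (partial_s e j f p * partial_lam g p - partial_lam f p * partial_s e j g p))"

lemma partial_s_coord_s:
  assumes "inj_on e {1..2*K+2}" "j \<in> {1..2*K+2}" "l \<in> {1..2*K+2}"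
  shows "partial_s e j (coord_s e l) p = of_bool (j = l)"
proof (cases "j = l")
  case False
  then have "e l \<noteq> e j"
    using assms by (auto dest: inj_onD)
  then show ?thesis
    using False by (simp add: partial_s_def coord_s_def)
qed (simp add: partial_s_def coord_s_def)

lemma partial_simps:
  "partial_s e j coord_lam p = 0" "partial_lam (coord_s e l) p = 0" "partial_lam coord_lam p = 1"
  by (simp_all add: partial_s_def partial_lam_def coord_s_def coord_lam_def)

lemma fn_bracket_coords:
  assumes "inj_on e {1..2*K+2}" "j \<in> {1..2*K+2}"
  shows "l \<in> {1..2*K+2} \<Longrightarrow> fn_bracket K e (coord_s e j) (coord_s e l) p = fn_ss K e j l p"
    and "fn_bracket K e (coord_s e j) coord_lam p = fn_slam e j p"
proof -
  have *: "partial_s e i (coord_s e k) p = of_bool (i = k)"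
    if "i \<in> {1..2*K+2}" "k \<in> {1..2*K+2}" for i k
    using partial_s_coord_s assms(1) that by blast
  show "fn_bracket K e (coord_s e j) (coord_s e l) p = fn_ss K e j l p" if l: "l \<in> {1..2*K+2}"
  proof -
    have "fn_bracket K e (coord_s e j) (coord_s e l) p =
      (\<Sum>i=1..2*K+2. \<Sum>k=1..2*K+2. if k = l then (if i = j then fn_ss K e i k p else 0) else 0)"
      unfolding fn_bracket_def partial_simps mult_zero_left mult_zero_right diff_self sum.neutral_const
        add_0_right
      by (intro sum.cong refl) (use * assms(2) l in auto)
    also have "\<dots> = (\<Sum>i=1..2*K+2. if i = j then fn_ss K e i l p else 0)"
      by (subst sum.delta) (use l in auto)
    also have "\<dots> = fn_ss K e j l p"
      by (subst sum.delta) (use assms(2) in auto)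
    finally show ?thesis .
  qed
  have "fn_bracket K e (coord_s e j) coord_lam p =
      (\<Sum>i=1..2*K+2. if i = j then fn_slam e i p else 0)"
    unfolding fn_bracket_def partial_simps mult_zero_left mult_zero_right diff_zero mult_1_right
      sum.neutral_const add_0_left
    by (intro sum.cong refl) (use * assms(2) in auto)
  also have "\<dots> = fn_slam e j p"
    by (subst sum.delta) (use assms(2) in auto)
  finally show "fn_bracket K e (coord_s e j) coord_lam p = fn_slam e j p" .
qed

definition fn_bracket_mat ::
  "nat \<Rightarrow> (nat \<Rightarrow> 'n::finite) \<Rightarrow> ('n phase \<Rightarrow> complex) \<Rightarrow> ('n phase \<Rightarrow> complex^2^2) \<Rightarrow> 'n phase \<Rightarrow> complex^2^2"
  where
  "fn_bracket_mat K e f G p = (\<chi> a b. fn_bracket K e f (\<lambda>q. G q $ a $ b) p)"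

definition mat22 :: "complex \<Rightarrow> complex \<Rightarrow> complex \<Rightarrow> complex \<Rightarrow> complex^2^2" where
  "mat22 a b c d = vector [vector [a, b], vector [c, d]]"

definition sigma3 :: "complex^2^2" where "sigma3 = mat22 1 0 0 (-1)"
definition sigma_plus :: "complex^2^2" where "sigma_plus = mat22 0 1 0 0"
definition sigma_minus :: "complex^2^2" where "sigma_minus = mat22 0 0 1 0"

definition commutator :: "complex^2^2 \<Rightarrow> complex^2^2 \<Rightarrow> complex^2^2" where
  "commutator A B = A ** B - B ** A"

definition mat_scale :: "complex \<Rightarrow> complex^2^2 \<Rightarrow> complex^2^2" where
  "mat_scale c A = (\<chi> a b. c * A $ a $ b)"

definition F_factor :: "(nat \<Rightarrow> 'n::finite) \<Rightarrow> 'n phase \<Rightarrow> nat \<Rightarrow> complex^2^2" where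
  "F_factor e p j = (if odd j then mat22 1 (coord_s e j p) 0 1 else mat22 1 0 (coord_s e j p) 1)"

definition F_mat :: "nat \<Rightarrow> (nat \<Rightarrow> 'n::finite) \<Rightarrow> 'n phase \<Rightarrow> complex^2^2" where
  "F_mat K e p =
     foldr (**) (map (F_factor e p) [1..<2*K+3])
       (mat22 (coord_lam p) 0 0 (inverse (coord_lam p)))"

text \<open>Holomorphic functions of several variables: the total derivative is complex linear.\<close>

definition holo_on :: "('n::finite) phase set \<Rightarrow> ('n phase \<Rightarrow> complex) \<Rightarrow> bool" where
  "holo_on U f \<longleftrightarrow> (\<forall>p\<in>U. \<exists>D. (f has_derivative D) (at p) \<and>
     (\<forall>c v w. D (c *s v, c * w) = c * D (v, w)))"

definition casimir_on ::
  "nat \<Rightarrow> (nat \<Rightarrow> 'n::finite) \<Rightarrow> 'n phase set \<Rightarrow> ('n phase \<Rightarrow> complex) \<Rightarrow> bool" where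
  "casimir_on K e U f \<longleftrightarrow> holo_on U f \<and> (\<forall>g. holo_on U g \<longrightarrow> (\<forall>p\<in>U. fn_bracket K e f g p = 0))"

text \<open>
  \<open>f\<close> depends functionally on \<open>g\<close>: near every point of some dense open subset of \<open>U\<close>, \<open>f\<close> is a
  holomorphic function of \<open>g\<close>.
\<close>

definition functionally_dependent_on ::
  "('n::finite) phase set \<Rightarrow> ('n phase \<Rightarrow> complex) \<Rightarrow> ('n phase \<Rightarrow> complex) \<Rightarrow> bool" where
  "functionally_dependent_on U f g \<longleftrightarrow>
     (\<exists>V. open V \<and> V \<subseteq> U \<and> U \<subseteq> closure V \<and>
       (\<forall>p\<in>V. \<exists>W D \<phi>. open W \<and> p \<in> W \<and> W \<subseteq> V \<and> open D \<and> g ` W \<subseteq> D \<and>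
          \<phi> holomorphic_on D \<and> (\<forall>q\<in>W. f q = \<phi> (g q))))"

text \<open>
  The regular functions are the elements of \<open>\<complex>[s\<^sub>1,\<dots>,s\<^sub>2\<^sub>K\<^sub>+\<^sub>2,\<lambda>,\<lambda>\<^sup>-\<^sup>1]\<close>, viewed as functions; by the last
  rule, the values off \<open>phase_space\<close> are irrelevant.
\<close>

inductive_set regular_functions :: "(('n::finite) phase \<Rightarrow> complex) set" where
  const: "(\<lambda>_. c) \<in> regular_functions"
| coord: "(\<lambda>p. fst p $ i) \<in> regular_functions"
| lam: "coord_lam \<in> regular_functions"
| lam_inv: "(\<lambda>p. inverse (coord_lam p)) \<in> regular_functions"
| add: "f \<in> regular_functions \<Longrightarrow> g \<in> regular_functions \<Longrightarrow> (\<lambda>p. f p + g p) \<in> regular_functions"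
| mult: "f \<in> regular_functions \<Longrightarrow> g \<in> regular_functions \<Longrightarrow> (\<lambda>p. f p * g p) \<in> regular_functions"
| cong: "f \<in> regular_functions \<Longrightarrow> (\<And>p. p \<in> phase_space \<Longrightarrow> g p = f p) \<Longrightarrow> g \<in> regular_functions"

text \<open>For finite \<open>G\<close>.\<close>

definition regular_ideal :: "(('n::finite) phase \<Rightarrow> complex) set \<Rightarrow> ('n phase \<Rightarrow> complex) set" where
  "regular_ideal G = {f. \<exists>h. (\<forall>g\<in>G. h g \<in> regular_functions) \<and>
     (\<forall>p\<in>phase_space. f p = (\<Sum>g\<in>G. h g p * g p))}"

text \<open>
  \<open>S\<close> is the subvariety cut out by the finite set \<open>G\<close> of regular functions, and the ideal generated
  by \<open>G\<close> (not its radical) is closed under bracketing with regular functions.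
\<close>

definition poisson_subvariety ::
  "nat \<Rightarrow> (nat \<Rightarrow> 'n::finite) \<Rightarrow> ('n phase \<Rightarrow> complex) set \<Rightarrow> 'n phase set \<Rightarrow> bool" where
  "poisson_subvariety K e G S \<longleftrightarrow>
     finite G \<and> G \<subseteq> regular_functions \<and> S = {p \<in> phase_space. \<forall>g\<in>G. g p = 0} \<and>
     (\<forall>f\<in>regular_ideal G. \<forall>h\<in>regular_functions. fn_bracket K e f h \<in> regular_ideal G)"

definition F_entries :: "nat \<Rightarrow> (nat \<Rightarrow> 'n::finite) \<Rightarrow> ('n phase \<Rightarrow> complex) set" where
  "F_entries K e = {(\<lambda>p. (F_mat K e p - mat 1) $ a $ b) | a b. True}"

definition S_variety :: "nat \<Rightarrow> (nat \<Rightarrow> 'n::finite) \<Rightarrow> 'n phase set" where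
  "S_variety K e = {p \<in> phase_space. F_mat K e p = mat 1}"

end

theory Submission
  imports Defs
begin

text \<open>
  Write \<open>E\<^sub>k\<close> for the \<open>k\<close>-th factor of \<open>F\<close>, \<open>A\<^sub>k = E\<^sub>1 \<dots> E\<^bsub>k-1\<^esub>\<close>, \<open>w\<^sub>k = (-1)\<^sup>k s\<^sub>k\<close> and \<open>N = 2K+2\<close>.  The matrices
  \<open>P\<^sub>k = \<partial>F/\<partial>s\<^sub>k = A\<^sub>k \<sigma>\<^sub>\<plusminus> A\<^sub>k\<^sup>-\<^sup>1 F\<close> (\<open>F_deriv\<close>) and \<open>Q\<^sub>k = A\<^sub>k \<sigma>\<^sub>3 A\<^sub>k\<^sup>-\<^sup>1 F\<close> (\<open>F_diag\<close>) satisfy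
  \<open>Q\<^bsub>k+1\<^esub> = Q\<^sub>k + 2 w\<^sub>k P\<^sub>k\<close> and \<open>P\<^bsub>k+1\<^esub> = P\<^bsub>k-1\<^esub> - w\<^sub>k Q\<^sub>k - w\<^sub>k\<^sup>2 P\<^sub>k\<close>, because conjugation by \<open>E\<^sub>k\<close> acts on
  \<open>\<sigma>\<^sub>+, \<sigma>\<^sub>-, \<sigma>\<^sub>3\<close> in this way.  Away from the wrap-around term \<open>{s\<^sub>l, s\<^sub>k}\<close> is
  \<open>\<plusminus>w\<^sub>l w\<^sub>k\<close>, plus \<open>\<plusminus>1\<close> when \<open>k\<close> and \<open>l\<close> are neighbours, so the sum defining \<open>{s\<^sub>l, F}\<close> telescopes to
  \<open>-w\<^sub>l (Q\<^sub>1 + Q\<^bsub>N+1\<^esub>)/2\<close> with \<open>Q\<^sub>1 = \<sigma>\<^sub>3 F\<close> and \<open>Q\<^bsub>N+1\<^esub> = F \<sigma>\<^sub>3\<close>.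

  All brackets of \<open>F\<close> with coordinates are thus commutators with \<open>F\<close>, equally with \<open>F - 1\<close>: traces vanish,
  and the ideal generated by \<open>F - 1\<close> is Poisson.  Conversely the differential of a Casimir function obeys
  the same recursion, hence has the form \<open>u\<^sub>k = tr (X P\<^sub>k F\<^sup>-\<^sup>1)\<close> for a traceless \<open>X\<close>, and the closing conditions
  say \<open>[X, F] = 0\<close>.  Where \<open>F\<^sub>2\<^sub>1 \<noteq> 0\<close> this makes it a multiple of \<open>d tr F\<close>.
\<close>

section \<open>Factorisations of the matrix F\<close>

text \<open>The derivative of the \<open>k\<close>-th factor in its own coordinate. The value
  \<open>sig 0\<close> is meant as well: it belongs to the virtual index \<open>0\<close> of the
  recursion.\<close>

definition sig :: "nat \<Rightarrow> complex^2^2" where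
  "sig k = (if odd k then sigma_plus else sigma_minus)"

definition signed_s :: "(nat \<Rightarrow> 'n::finite) \<Rightarrow> 'n phase \<Rightarrow> nat \<Rightarrow> complex" where
  "signed_s e p k = (-1) ^ k * coord_s e k p"

definition F_left :: "(nat \<Rightarrow> 'n::finite) \<Rightarrow> 'n phase \<Rightarrow> nat \<Rightarrow> complex^2^2" where
  "F_left e p k = foldr (**) (map (F_factor e p) [1..<k]) (mat 1)"

definition F_right :: "nat \<Rightarrow> (nat \<Rightarrow> 'n::finite) \<Rightarrow> 'n phase \<Rightarrow> nat \<Rightarrow> complex^2^2" where
  "F_right K e p k = foldr (**) (map (F_factor e p) [k..<2*K+3])
       (mat22 (coord_lam p) 0 0 (inverse (coord_lam p)))"

text \<open>Used for \<open>k\<close> from \<open>0\<close> to \<open>2*K+3\<close>. The two outer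
  indices are not derivatives; they supply the neighbours that the recursion needs at both
  ends.\<close>

definition F_deriv :: "nat \<Rightarrow> (nat \<Rightarrow> 'n::finite) \<Rightarrow> 'n phase \<Rightarrow> nat \<Rightarrow> complex^2^2" where
  "F_deriv K e p k = F_left e p k ** sig k ** F_right K e p (Suc k)"

definition F_diag :: "nat \<Rightarrow> (nat \<Rightarrow> 'n::finite) \<Rightarrow> 'n phase \<Rightarrow> nat \<Rightarrow> complex^2^2" where
  "F_diag K e p k = F_left e p k ** sigma3 ** F_right K e p k"

lemma mat22_entries [simp]:
  "mat22 a b c d $ 1 $ 1 = a" "mat22 a b c d $ 1 $ 2 = b"
  "mat22 a b c d $ 2 $ 1 = c" "mat22 a b c d $ 2 $ 2 = d"
  by (simp_all add: mat22_def)

lemma mat_1_entries [simp]: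
  "(mat 1 :: complex^2^2) $ 1 $ 1 = 1" "(mat 1 :: complex^2^2) $ 1 $ 2 = 0"
  "(mat 1 :: complex^2^2) $ 2 $ 1 = 0" "(mat 1 :: complex^2^2) $ 2 $ 2 = 1"
  by (simp_all add: mat_def)

lemma matrix_mult_entry: "((A::complex^2^2) ** B) $ a $ b = A $ a $ 1 * B $ 1 $ b + A $ a $ 2 * B $ 2 $ b"
  by (simp add: matrix_matrix_mult_def sum_2)

lemma trace_22: "trace (A::complex^2^2) = A $ 1 $ 1 + A $ 2 $ 2"
  by (simp add: trace_def sum_2)

lemma mat_eq_22:
  "(A::complex^2^2) = B \<longleftrightarrow> A $ 1 $ 1 = B $ 1 $ 1 \<and> A $ 1 $ 2 = B $ 1 $ 2 \<and> A $ 2 $ 1 = B $ 2 $ 1 \<and> A $ 2 $ 2 = B $ 2 $ 2"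
  by (auto simp: vec_eq_iff forall_2)

section \<open>Splitting the product at one factor\<close>

lemma foldr_matrix_mult:
  "foldr (**) xs (M :: complex^2^2) = foldr (**) xs (mat 1) ** M"
  by (induction xs) (simp_all flip: matrix_mul_assoc)

lemma F_left_1 [simp]: "F_left e p (Suc 0) = mat 1" "F_left e p 0 = mat 1"
  by (simp_all add: F_left_def)

lemma F_left_Suc: "1 \<le> k \<Longrightarrow> F_left e p (Suc k) = F_left e p k ** F_factor e p k"
  unfolding F_left_def by (simp add: foldr_matrix_mult[of _ "F_factor e p k"])

lemma F_right_Suc: "k \<le> 2*K+2 \<Longrightarrow> F_right K e p k = F_factor e p k ** F_right K e p (Suc k)"
  unfolding F_right_def by (simp add: upt_rec)

lemma F_right_last:
  "2*K+3 \<le> k \<Longrightarrow> F_right K e p k = mat22 (coord_lam p) 0 0 (inverse (coord_lam p))"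
  unfolding F_right_def by simp

lemma F_mat_split: "1 \<le> k \<Longrightarrow> k \<le> 2*K+3 \<Longrightarrow> F_mat K e p = F_left e p k ** F_right K e p k"
  unfolding F_left_def F_right_def F_mat_def
  using upt_add_eq_append[of 1 k "2*K+3 - k"]
  by (simp del: upt_Suc) (rule foldr_matrix_mult)

lemma F_right_1: "F_right K e p 1 = F_mat K e p"
  by (simp add: F_right_def F_mat_def)

text \<open>The nilpotent \<open>sig k\<close> absorbs its own factor, so this factor may be kept on
  the right. For \<open>k = 2*K+3\<close> both right parts are the bare diagonal matrix.\<close>

lemma F_deriv_left:
  assumes "1 \<le> k" "k \<le> 2*K+3"
  shows "F_deriv K e p k = F_left e p k ** sig k ** F_right K e p k"
proof (cases "k = 2*K+3")
  case True
  then show ?thesis by (simp add: F_deriv_def F_right_last)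
next
  case False
  have "sig k ** F_factor e p k = sig k"
    by (simp add: mat_eq_22 matrix_mult_entry sig_def F_factor_def sigma_plus_def sigma_minus_def)
  then show ?thesis
    using False assms by (simp add: F_deriv_def F_right_Suc[of k] flip: matrix_mul_assoc)
      (simp add: matrix_mul_assoc)
qed

text \<open>Mirror image: the factor is absorbed from the left. For \<open>k = 0\<close> both left
  parts are the identity.\<close>

lemma F_deriv_right:
  "F_deriv K e p k = F_left e p (Suc k) ** sig k ** F_right K e p (Suc k)"
proof (cases "k = 0")
  case True
  then show ?thesis by (simp add: F_deriv_def)
next
  case False
  have "F_factor e p k ** sig k = sig k"
    by (simp add: mat_eq_22 matrix_mult_entry sig_def F_factor_def sigma_plus_def sigma_minus_def)
  then show ?thesis
    using False by (simp add: F_deriv_def F_left_Suc flip: matrix_mul_assoc)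
qed

text \<open>Second order in \<open>u\<close> and first order in \<open>q\<close>, hence fixed by
  \<open>u 0\<close>, \<open>u 1\<close> and \<open>q 1\<close>. Scalar sequences make it applicable
  to matrix entries, to traces and to differentials of Casimir functions alike.\<close>

definition bracket_chain :: "nat \<Rightarrow> (nat \<Rightarrow> complex) \<Rightarrow> (nat \<Rightarrow> complex) \<Rightarrow> (nat \<Rightarrow> complex) \<Rightarrow> bool" where
  "bracket_chain N w u q \<longleftrightarrow> (\<forall>k\<in>{1..N}. q (Suc k) = q k + 2 * w k * u k \<and>
     u (Suc k) = u (k - 1) - w k * q k - (w k)\<^sup>2 * u k)"

lemma bracket_chain_F:
  "bracket_chain (2*K+2) (signed_s e p) (\<lambda>k. F_deriv K e p k $ a $ b) (\<lambda>k. F_diag K e p k $ a $ b)"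
  unfolding bracket_chain_def
proof (intro ballI)
  fix k assume k: "k \<in> {1..2*K+2}"
  \<comment> \<open>All five matrices share the outer parts \<open>A\<close> and \<open>B\<close>.
    What remains are two identities for one unipotent factor \<open>E\<close>:
    \<open>E sigma3 = sigma3 E + 2 w sig k\<close> and
    \<open>E sig' = sig' E - w sigma3 E - w^2 sig k\<close>, where \<open>sig'\<close> is
    \<open>sig (Suc k)\<close>.\<close>
  define A where "A = F_left e p k"
  define B where "B = F_right K e p (Suc k)"
  let ?E = "F_factor e p k" and ?w = "signed_s e p k"
  have eqs: "F_deriv K e p k = A ** sig k ** B"
    "F_deriv K e p (Suc k) = A ** ?E ** sig (Suc k) ** B"
    "F_deriv K e p (k - 1) = A ** sig (Suc k) ** (?E ** B)"
    "F_diag K e p k = A ** sigma3 ** (?E ** B)" "F_diag K e p (Suc k) = A ** ?E ** sigma3 ** B"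
  proof -
    have k': "1 \<le> k" "k \<le> 2*K+2" "1 \<le> Suc k" "Suc k \<le> 2*K+3" "Suc (k - 1) = k"
      using k by auto
    have "sig (k - 1) = sig (Suc k)"
      using k by (auto simp: sig_def)
    then show "F_deriv K e p (k - 1) = A ** sig (Suc k) ** (?E ** B)"
      using k' F_deriv_right[of K e p "k - 1"] by (simp add: A_def B_def F_right_Suc)
    show "F_deriv K e p (Suc k) = A ** ?E ** sig (Suc k) ** B"
      using k' F_deriv_left[of "Suc k" K] by (simp add: A_def B_def F_left_Suc)
    show "F_deriv K e p k = A ** sig k ** B" "F_diag K e p k = A ** sigma3 ** (?E ** B)"
      "F_diag K e p (Suc k) = A ** ?E ** sigma3 ** B"
      using k' by (simp_all add: A_def B_def F_deriv_def F_diag_def F_left_Suc F_right_Suc)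
  qed
  show "F_diag K e p (Suc k) $ a $ b = F_diag K e p k $ a $ b + 2 * ?w * F_deriv K e p k $ a $ b \<and>
    F_deriv K e p (Suc k) $ a $ b = F_deriv K e p (k - 1) $ a $ b - ?w * F_diag K e p k $ a $ b
      - ?w\<^sup>2 * F_deriv K e p k $ a $ b"
    unfolding eqs by (cases "odd k")
      (simp_all add: sig_def F_factor_def matrix_mult_entry sigma_plus_def sigma_minus_def sigma3_def
        signed_s_def algebra_simps power2_eq_square)
qed

lemma F_diag_ends:
  "F_diag K e p 1 = sigma3 ** F_mat K e p" "F_diag K e p (2*K+3) = F_mat K e p ** sigma3"
proof -
  show "F_diag K e p 1 = sigma3 ** F_mat K e p"
    using F_right_1[of K e p] by (simp add: F_diag_def)
  \<comment> \<open>The final diagonal factor commutes with \<open>sigma3\<close>, which therefore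
    moves to the right end.\<close>
  have "F_diag K e p (2*K+3) = F_left e p (2*K+3) ** (F_right K e p (2*K+3) ** sigma3)"
    by (simp add: F_diag_def F_right_last flip: matrix_mul_assoc)
      (simp add: matrix_mult_entry mat_eq_22 sigma3_def)
  then show "F_diag K e p (2*K+3) = F_mat K e p ** sigma3"
    by (simp add: F_mat_split[of "2*K+3"] matrix_mul_assoc)
qed

text \<open>Moving \<open>sigma_plus\<close> or \<open>sigma_minus\<close> across the diagonal
  factor costs a power of \<open>\<lambda>\<^sup>2\<close>. This is what matches the
  \<open>1/\<lambda>\<^sup>2\<close> of the wrap-around bracket.\<close>

lemma F_deriv_ends:
  assumes "p \<in> phase_space"
  shows "F_deriv K e p 0 = sigma_minus ** F_mat K e p"
    and "F_deriv K e p 1 = sigma_plus ** F_mat K e p"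
    and "F_deriv K e p (2*K+2) = mat_scale ((coord_lam p)\<^sup>2) (F_mat K e p ** sigma_minus)"
    and "F_deriv K e p (2*K+3) = mat_scale (1 / (coord_lam p)\<^sup>2) (F_mat K e p ** sigma_plus)"
proof -
  have lam: "coord_lam p \<noteq> 0"
    using assms by (simp add: phase_space_def coord_lam_def)
  show "F_deriv K e p 0 = sigma_minus ** F_mat K e p"
    using F_right_1[of K e p] by (simp add: F_deriv_def sig_def)
  show "F_deriv K e p 1 = sigma_plus ** F_mat K e p"
    using F_right_1[of K e p] F_deriv_left[of 1 K e p] by (simp add: sig_def)
  have split: "F_mat K e p = F_left e p (Suc (2*K+2)) ** mat22 (coord_lam p) 0 0 (inverse (coord_lam p))"
    using F_mat_split[of "2*K+3" K e p] F_right_last[of K "2*K+3" e p] by (simp add: numeral_3_eq_3)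
  show "F_deriv K e p (2*K+2) = mat_scale ((coord_lam p)\<^sup>2) (F_mat K e p ** sigma_minus)"
    unfolding F_deriv_right split using lam F_right_last[of K "Suc (2*K+2)" e p]
    by (simp add: matrix_mult_entry mat_eq_22 sig_def sigma_minus_def mat_scale_def power2_eq_square)
  show "F_deriv K e p (2*K+3) = mat_scale (1 / (coord_lam p)\<^sup>2) (F_mat K e p ** sigma_plus)"
    unfolding F_deriv_def split using lam F_right_last[of K "Suc (2*K+3)" e p]
    by (simp add: matrix_mult_entry mat_eq_22 sig_def sigma_plus_def mat_scale_def power2_eq_square
        divide_simps numeral_3_eq_3)
qed

section \<open>The bracket on coordinates\<close>

declare sum.cl_ivl_Suc [simp del]

lemma fn_ss_antisym: "fn_ss K e j l p = - fn_ss K e l j p"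
  by (simp add: fn_ss_def)

lemma fn_bracket_antisym: "fn_bracket K e f g p = - fn_bracket K e g f p"
proof -
  have "(\<Sum>j=1..2*K+2. \<Sum>l=1..2*K+2. fn_ss K e j l p * partial_s e j f p * partial_s e l g p)
    = (\<Sum>l=1..2*K+2. \<Sum>j=1..2*K+2. - (fn_ss K e l j p * partial_s e l g p * partial_s e j f p))"
    by (subst sum.swap, intro sum.cong refl, subst fn_ss_antisym) simp
  moreover have "(\<Sum>j=1..2*K+2. fn_slam e j p *
      (partial_s e j f p * partial_lam g p - partial_lam f p * partial_s e j g p))
    = - (\<Sum>j=1..2*K+2. fn_slam e j p *
      (partial_s e j g p * partial_lam f p - partial_lam g p * partial_s e j f p))"
    unfolding sum_negf[symmetric] by (intro sum.cong refl) (simp add: algebra_simps)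
  ultimately show ?thesis
    unfolding fn_bracket_def by (simp only: sum_negf minus_add_distrib)
qed

context
  fixes K :: nat and e :: "nat \<Rightarrow> 'n::finite"
  assumes inj: "inj_on e {1..2*K+2}"
begin

lemma fn_bracket_coord_s:
  assumes "l \<in> {1..2*K+2}"
  shows "fn_bracket K e (coord_s e l) g p =
    (\<Sum>k=1..2*K+2. fn_ss K e l k p * partial_s e k g p) + fn_slam e l p * partial_lam g p"
proof -
  have *: "partial_s e j (coord_s e l) p = of_bool (j = l)" if "j \<in> {1..2*K+2}" for j
    using partial_s_coord_s[OF inj] that assms by blast
  have "(\<Sum>j=1..2*K+2. \<Sum>k=1..2*K+2. fn_ss K e j k p * partial_s e j (coord_s e l) p * partial_s e k g p)
    = (\<Sum>j=1..2*K+2. if j = l then \<Sum>k=1..2*K+2. fn_ss K e l k p * partial_s e k g p else 0)"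
    by (intro sum.cong refl, subst *) auto
  moreover have "(\<Sum>j=1..2*K+2. fn_slam e j p * (partial_s e j (coord_s e l) p * partial_lam g p))
    = (\<Sum>j=1..2*K+2. if j = l then fn_slam e l p * partial_lam g p else 0)"
    by (intro sum.cong refl, subst *) auto
  ultimately show ?thesis
    unfolding fn_bracket_def partial_simps using assms by (simp add: sum.delta)
qed

lemma fn_bracket_coord_lam:
  "fn_bracket K e coord_lam g p = - (\<Sum>k=1..2*K+2. fn_slam e k p * partial_s e k g p)"
  unfolding fn_bracket_def partial_simps by (simp add: sum_negf)

text \<open>Reduces a bracket to those with a coordinate in the first slot, the only ones computed
  explicitly.\<close>

lemma fn_bracket_expand:
  "fn_bracket K e f g p = (\<Sum>j=1..2*K+2. partial_s e j f p * fn_bracket K e (coord_s e j) g p)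
     + partial_lam f p * fn_bracket K e coord_lam g p"
proof -
  have "(\<Sum>j=1..2*K+2. partial_s e j f p * fn_bracket K e (coord_s e j) g p)
    = (\<Sum>j=1..2*K+2. partial_s e j f p *
       ((\<Sum>k=1..2*K+2. fn_ss K e j k p * partial_s e k g p) + fn_slam e j p * partial_lam g p))"
    by (intro sum.cong refl) (simp add: fn_bracket_coord_s)
  then show ?thesis
    unfolding fn_bracket_coord_lam unfolding fn_bracket_def
    by (simp add: distrib_left sum.distrib sum_distrib_left sum_subtractf algebra_simps
       )
qed

end

text \<open>Continues the sequence \<open>u\<close> of \<open>s\<close>-derivatives to the indices \<open>0\<close> and \<open>2K+3\<close>, so that the wrap-around
  term \<open>-1/\<lambda>\<^sup>2\<close> of the bracket takes the same form as its neighbour terms.\<close>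

definition wrap :: "nat \<Rightarrow> complex \<Rightarrow> (nat \<Rightarrow> complex) \<Rightarrow> nat \<Rightarrow> complex" where
  "wrap K \<mu> u k = (if k = 0 then u (2*K+2) / \<mu>\<^sup>2 else if k = 2*K+3 then u 1 / \<mu>\<^sup>2 else u k)"

text \<open>One formula for all orders of \<open>l\<close> and \<open>k\<close>. The factor
  \<open>2 * of_bool (k < l) + of_bool (k = l) - 1\<close> is the sign of \<open>l - k\<close>,
  written so that summation over \<open>k\<close> produces a partial sum and a total.\<close>

lemma fn_ss_eq:
  assumes "l \<in> {1..2*K+2}" "k \<in> {1..2*K+2}"
  shows "fn_ss K e l k p = of_bool (k = Suc l) - of_bool (Suc k = l)
    - of_bool (l = 1 \<and> k = 2*K+2) / (coord_lam p)\<^sup>2 + of_bool (l = 2*K+2 \<and> k = 1) / (coord_lam p)\<^sup>2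
    + signed_s e p l * (2 * of_bool (k < l) + of_bool (k = l) - 1) * signed_s e p k"
proof -
  have sgn: "(-1) powi (int j - int i + 1) = - ((-1) ^ j * (-1) ^ i :: complex)" for i j
    by (cases "even i"; cases "even j") (simp_all add: power_int_add power_int_diff)
  have upper: "fn_ss_upper K e j i p = of_bool (j + 1 = i) - of_bool (j = 1 \<and> i = 2*K+2) / (coord_lam p)\<^sup>2
      - signed_s e p j * signed_s e p i" for i j
    unfolding fn_ss_upper_def sgn signed_s_def by simp
  consider "l < k" | "l = k" | "k < l" by linarith
  then show ?thesis
    using assms by cases (auto simp: fn_ss_def upper algebra_simps)
qed

text \<open>The neighbour terms pick out the entries at \<open>l + 1\<close> and
  \<open>l - 1\<close>. At \<open>l = 1\<close> and \<open>l = 2*K+2\<close> one neighbour is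
  missing, and the wrap-around term replaces it by the value built into \<open>wrap\<close>.\<close>

lemma fn_ss_sum:
  fixes e :: "nat \<Rightarrow> 'n::finite" and p :: "'n phase"
  assumes "K \<ge> 1" "l \<in> {1..2*K+2}"
  defines "w \<equiv> signed_s e p"
  shows "(\<Sum>k=1..2*K+2. fn_ss K e l k p * u k) =
    wrap K (coord_lam p) u (Suc l) - wrap K (coord_lam p) u (l - 1)
      + w l * (2 * (\<Sum>k=1..<l. w k * u k) + w l * u l - (\<Sum>k=1..2*K+2. w k * u k))"
proof -
  let ?N = "2*K+2"
  have "(\<Sum>k=1..?N. fn_ss K e l k p * u k) =
    (\<Sum>k=1..?N. (if k = Suc l then u k else 0) - (if k = l - 1 then u k else 0)
      - (if k = ?N then of_bool (l = 1) * u k / (coord_lam p)\<^sup>2 else 0)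
      + (if k = 1 then of_bool (l = ?N) * u k / (coord_lam p)\<^sup>2 else 0)
      + w l * (2 * (if k < l then w k * u k else 0) + (if k = l then w k * u k else 0) - w k * u k))"
    using assms(1,2)
    by (intro sum.cong refl, subst fn_ss_eq[OF assms(2)]) (auto simp: w_def algebra_simps)
  also have "\<dots> = (\<Sum>k=1..?N. if k = Suc l then u k else 0) - (\<Sum>k=1..?N. if k = l - 1 then u k else 0)
      - (\<Sum>k=1..?N. if k = ?N then of_bool (l = 1) * u k / (coord_lam p)\<^sup>2 else 0)
      + (\<Sum>k=1..?N. if k = 1 then of_bool (l = ?N) * u k / (coord_lam p)\<^sup>2 else 0)
      + w l * (2 * (\<Sum>k=1..?N. if k < l then w k * u k else 0)
        + (\<Sum>k=1..?N. if k = l then w k * u k else 0) - (\<Sum>k=1..?N. w k * u k))"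
    by (simp only: sum.distrib sum_subtractf sum_distrib_left[symmetric])
  also have "(\<Sum>k=1..?N. if k < l then w k * u k else 0) = (\<Sum>k=1..<l. w k * u k)"
    using assms(2) by (intro sum.mono_neutral_cong_right) auto
  finally show ?thesis
    using assms(1,2) by (auto simp: sum.delta wrap_def)
qed

lemma bracket_chain_sum:
  assumes "bracket_chain N w u q" "1 \<le> l" "l \<le> Suc N"
  shows "q l = q 1 + 2 * (\<Sum>k=1..<l. w k * u k)"
  using assms(2,3)
proof (induction l rule: dec_induct)
  case (step l)
  then show ?case
    using assms(1) by (simp add: bracket_chain_def algebra_simps)
qed simp

text \<open>The recursion turns the difference of the neighbours into terms in \<open>q l\<close>,
  and twice the partial sum is \<open>q l - q 1\<close>. Everything depending on the interior
  cancels, leaving only the two ends of \<open>q\<close>.\<close>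

lemma bracket_chain_step:
  assumes "bracket_chain N w u q" "l \<in> {1..N}"
  shows "u (Suc l) - u (l - 1) + w l * (2 * (\<Sum>k=1..<l. w k * u k) + w l * u l - (\<Sum>k=1..N. w k * u k))
    = - w l * (q 1 + q (Suc N)) / 2"
proof -
  have "q l = q 1 + 2 * (\<Sum>k=1..<l. w k * u k)"
    using bracket_chain_sum[OF assms(1), of l] assms(2) by auto
  moreover have "q (Suc N) = q 1 + 2 * (\<Sum>k=1..N. w k * u k)"
    using bracket_chain_sum[OF assms(1), of "Suc N"] by (simp add: atLeastLessThanSuc_atLeastAtMost)
  moreover have "u (Suc l) = u (l - 1) - w l * q l - (w l)\<^sup>2 * u l"
    using assms by (auto simp: bracket_chain_def)
  ultimately have "2 * (u (Suc l) - u (l - 1)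
      + w l * (2 * (\<Sum>k=1..<l. w k * u k) + w l * u l - (\<Sum>k=1..N. w k * u k)))
    = - w l * (q 1 + q (Suc N))"
    by algebra
  moreover have "2 * X = Y \<Longrightarrow> X = Y / 2" for X Y :: complex
    by auto
  ultimately show ?thesis
    by blast
qed

section \<open>Derivatives and brackets of F\<close>

definition upd_s :: "(nat \<Rightarrow> 'n::finite) \<Rightarrow> nat \<Rightarrow> complex \<Rightarrow> 'n phase \<Rightarrow> 'n phase" where
  "upd_s e j z p = (\<chi> i. if i = e j then z else fst p $ i, snd p)"

lemma partial_s_upd: "partial_s e j f p = deriv (\<lambda>z. f (upd_s e j z p)) (coord_s e j p)"
  by (simp add: partial_s_def upd_s_def)

lemma upd_s_simps [simp]:
  "coord_lam (upd_s e j z p) = coord_lam p" "coord_s e j (upd_s e j z p) = z"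
  "upd_s e j (coord_s e j p) p = p" "upd_s e j z (upd_s e j y p) = upd_s e j z p"
  by (auto simp: upd_s_def coord_lam_def coord_s_def vec_eq_iff prod_eq_iff)

context
  fixes K :: nat and e :: "nat \<Rightarrow> 'n::finite"
  assumes inj: "inj_on e {1..2*K+2}"
begin

lemma coord_s_upd_other:
  assumes "j \<in> {1..2*K+2}" "k \<in> {1..2*K+2}" "j \<noteq> k"
  shows "coord_s e j (upd_s e k z p) = coord_s e j p"
  using inj_onD[OF inj, of j k] assms by (auto simp: coord_s_def upd_s_def)

lemma F_factor_upd:
  "j \<in> {1..2*K+2} \<Longrightarrow> k \<in> {1..2*K+2} \<Longrightarrow> j \<noteq> k \<Longrightarrow>
    F_factor e (upd_s e k z p) j = F_factor e p j"
  by (simp add: F_factor_def coord_s_upd_other del: atLeastAtMost_iff)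

lemma F_left_upd:
  assumes "k \<in> {1..2*K+2}"
  shows "F_left e (upd_s e k z p) k = F_left e p k"
proof -
  have "map (F_factor e (upd_s e k z p)) [1..<k] = map (F_factor e p) [1..<k]"
    by (rule map_cong[OF refl], rule F_factor_upd) (use assms in auto)
  then show ?thesis
    unfolding F_left_def by (rule arg_cong)
qed

lemma F_right_upd:
  assumes "k \<in> {1..2*K+2}"
  shows "F_right K e (upd_s e k z p) (Suc k) = F_right K e p (Suc k)"
proof -
  have "map (F_factor e (upd_s e k z p)) [Suc k..<2*K+3] = map (F_factor e p) [Suc k..<2*K+3]"
    by (rule map_cong[OF refl], rule F_factor_upd) (use assms in auto)
  then show ?thesis
    unfolding F_right_def upd_s_simps by (rule arg_cong)
qed

text \<open>The coordinate \<open>s_k\<close> occurs in one factor only, and there linearly, so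
  \<open>F\<close> is affine in it.\<close>

lemma F_mat_upd:
  assumes k: "k \<in> {1..2*K+2}"
  shows "F_mat K e (upd_s e k z p) $ a $ b =
    (F_left e p k ** F_right K e p (Suc k)) $ a $ b + z * F_deriv K e p k $ a $ b"
proof -
  have "F_mat K e (upd_s e k z p) = F_left e p k ** (F_factor e (upd_s e k z p) k ** F_right K e p (Suc k))"
    using k F_mat_split[of k K e "upd_s e k z p"]
    by (simp add: F_left_upd F_right_Suc F_right_upd)
  then show ?thesis
    by (auto simp: F_deriv_def F_factor_def sig_def sigma_plus_def sigma_minus_def matrix_mult_entry
        algebra_simps)
qed

lemma partial_s_F:
  assumes "k \<in> {1..2*K+2}"
  shows "partial_s e k (\<lambda>q. F_mat K e q $ a $ b) p = F_deriv K e p k $ a $ b"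
  unfolding partial_s_upd F_mat_upd[OF assms]
  by (rule DERIV_imp_deriv) (auto intro!: derivative_eq_intros)

text \<open>Only the diagonal factor depends on \<open>\<lambda>\<close>, and its logarithmic
  derivative is \<open>sigma3\<close> divided by \<open>\<lambda>\<close>.\<close>

lemma partial_lam_F:
  assumes "p \<in> phase_space"
  shows "partial_lam (\<lambda>q. F_mat K e q $ a $ b) p = (F_mat K e p ** sigma3) $ a $ b / coord_lam p"
proof -
  have lam: "coord_lam p \<noteq> 0"
    using assms by (simp add: phase_space_def coord_lam_def)
  have "F_factor e (fst p, z) = F_factor e p" for z
    by (simp add: fun_eq_iff F_factor_def coord_s_def)
  then have left: "F_left e (fst p, z) n = F_left e p n" for z n
    by (simp add: F_left_def)
  have F: "F_mat K e (fst p, z) = F_left e p (2*K+3) ** mat22 z 0 0 (inverse z)" for z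
    using F_mat_split[of "2*K+3" K e "(fst p, z)"] F_right_last[of K "2*K+3" e "(fst p, z)"]
    by (simp add: left coord_lam_def)
  have "((\<lambda>z. F_mat K e (fst p, z) $ a $ b) has_field_derivative
      (F_mat K e p ** sigma3) $ a $ b / coord_lam p) (at (coord_lam p))"
  proof -
    let ?L = "F_left e p (2*K+3)" and ?z = "coord_lam p"
    have "F_mat K e p = ?L ** mat22 ?z 0 0 (inverse ?z)"
      using F[of ?z] by (simp add: coord_lam_def)
    then have "(F_mat K e p ** sigma3) $ a $ b / ?z =
      ?L $ a $ 1 * mat22 1 0 0 0 $ 1 $ b + ?L $ a $ 2 * (mat22 0 0 0 1 $ 2 $ b * - (inverse (?z ^ 2)))"
      using lam exhaust_2[of b]
      by (auto simp: matrix_mult_entry sigma3_def power2_eq_square divide_simps)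
    then show ?thesis
      unfolding F matrix_mult_entry using lam exhaust_2[of b]
      by (auto intro!: derivative_eq_intros simp: power2_eq_square)
  qed
  then show ?thesis
    unfolding partial_lam_def by (rule DERIV_imp_deriv)
qed

text \<open>A single formula for all \<open>l\<close>. Its \<open>sigma3\<close> part is the sum of
  the two ends of the chain and the \<open>\<lambda>\<close>-derivative; the other two commutators
  measure how far \<open>wrap\<close> differs from \<open>F_deriv\<close> at the virtual
  indices.\<close>

lemma fn_bracket_s_F:
  assumes "K \<ge> 1" "l \<in> {1..2*K+2}" "p \<in> phase_space"
  shows "fn_bracket K e (coord_s e l) (\<lambda>q. F_mat K e q $ a $ b) p =
    signed_s e p l / 2 * commutator (F_mat K e p) sigma3 $ a $ b
    + of_bool (l = 1) * commutator sigma_minus (F_mat K e p) $ a $ b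
    + of_bool (l = 2*K+2) * (1 / (coord_lam p)\<^sup>2 * commutator sigma_plus (F_mat K e p) $ a $ b)"
proof -
  let ?u = "\<lambda>k. F_deriv K e p k $ a $ b" and ?q = "\<lambda>k. F_diag K e p k $ a $ b" and ?w = "signed_s e p"
  have lam: "coord_lam p \<noteq> 0"
    using assms by (simp add: phase_space_def coord_lam_def)
  have "fn_bracket K e (coord_s e l) (\<lambda>q. F_mat K e q $ a $ b) p =
     (\<Sum>k=1..2*K+2. fn_ss K e l k p * ?u k)
       + fn_slam e l p * ((F_mat K e p ** sigma3) $ a $ b / coord_lam p)"
    unfolding fn_bracket_coord_s[OF inj assms(2)] partial_lam_F[OF assms(3)]
    by (intro arg_cong2[where f="(+)"] sum.cong refl) (simp add: partial_s_F)
  also have "fn_slam e l p * ((F_mat K e p ** sigma3) $ a $ b / coord_lam p)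
     = ?w l * (F_mat K e p ** sigma3) $ a $ b"
    using lam by (simp add: fn_slam_def signed_s_def)
  also have "(\<Sum>k=1..2*K+2. fn_ss K e l k p * ?u k) =
     wrap K (coord_lam p) ?u (Suc l) - wrap K (coord_lam p) ?u (l - 1) - (?u (Suc l) - ?u (l - 1))
      - ?w l * (?q 1 + ?q (Suc (2*K+2))) / 2"
    using fn_ss_sum[OF assms(1,2), of e p ?u] bracket_chain_step[OF bracket_chain_F assms(2), of e p a b]
    by algebra
  also have "Suc (2*K+2) = 2*K+3" by simp
  finally have bracket: "fn_bracket K e (coord_s e l) (\<lambda>q. F_mat K e q $ a $ b) p =
    (wrap K (coord_lam p) ?u (Suc l) - ?u (Suc l)) - (wrap K (coord_lam p) ?u (l - 1) - ?u (l - 1))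
      - ?w l * (?q 1 + ?q (2*K+3)) / 2 + ?w l * (F_mat K e p ** sigma3) $ a $ b"
    by (simp only: algebra_simps)
  \<comment> \<open>Nonzero only for \<open>l = 2*K+2\<close>: there \<open>wrap\<close> has
    \<open>sigma_plus\<close> to the left of \<open>F\<close>, while \<open>F_deriv\<close> has it
    to the right.\<close>
  have nxt: "wrap K (coord_lam p) ?u (Suc l) - ?u (Suc l) =
     of_bool (l = 2*K+2) * (1 / (coord_lam p)\<^sup>2 * commutator sigma_plus (F_mat K e p) $ a $ b)"
    using F_deriv_ends[OF assms(3), of K e]
    by (auto simp: wrap_def commutator_def mat_scale_def numeral_3_eq_3 diff_divide_distrib)
  \<comment> \<open>Nonzero only for \<open>l = 1\<close>, with \<open>sigma_minus\<close> on
    opposite sides of \<open>F\<close>.\<close>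
  have prev: "wrap K (coord_lam p) ?u (l - 1) - ?u (l - 1) =
     - of_bool (l = 1) * commutator sigma_minus (F_mat K e p) $ a $ b"
    using F_deriv_ends[OF assms(3), of K e] lam assms(2)
    by (auto simp: wrap_def commutator_def mat_scale_def)
  have comm: "commutator (F_mat K e p) sigma3 $ a $ b =
      (F_mat K e p ** sigma3) $ a $ b - (sigma3 ** F_mat K e p) $ a $ b"
    by (simp add: commutator_def)
  show ?thesis
    unfolding bracket nxt prev comm F_diag_ends
    by (simp add: add_divide_distrib diff_divide_distrib algebra_simps)
qed

text \<open>The sum of \<open>signed_s\<close> times \<open>F_deriv\<close> telescopes to half the
  difference of the ends of \<open>F_diag\<close>.\<close>

lemma fn_bracket_lam_F:
  assumes "p \<in> phase_space"
  shows "fn_bracket K e coord_lam (\<lambda>q. F_mat K e q $ a $ b) p =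
    coord_lam p / 2 * commutator sigma3 (F_mat K e p) $ a $ b"
proof -
  have "(\<Sum>k=1..2*K+2. fn_slam e k p * partial_s e k (\<lambda>q. F_mat K e q $ a $ b) p)
    = (\<Sum>k=1..2*K+2. coord_lam p * (signed_s e p k * F_deriv K e p k $ a $ b))"
    by (intro sum.cong refl) (simp add: partial_s_F fn_slam_def signed_s_def)
  also have "\<dots> = coord_lam p / 2 * (F_diag K e p (2*K+3) - F_diag K e p 1) $ a $ b"
    using bracket_chain_sum[OF bracket_chain_F[of K e p a b], of "2*K+3"]
    by (simp add: atLeastLessThanSuc_atLeastAtMost numeral_3_eq_3 flip: sum_distrib_left)
  finally show ?thesis
    unfolding fn_bracket_coord_lam[OF inj] F_diag_ends
    by (simp add: commutator_def algebra_simps)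
qed

end

section \<open>Holomorphic and regular functions\<close>

lemma open_phase_space: "open (phase_space :: 'n::finite phase set)"
proof -
  have "open (snd -` (- {0}) :: 'n phase set)"
    by (intro open_vimage_snd open_Compl closed_singleton)
  also have "(snd -` (- {0}) :: 'n phase set) = phase_space"
    by (auto simp: phase_space_def)
  finally show ?thesis .
qed

lemma upd_s_eq: "upd_s e j z p = p + (axis (e j) (z - coord_s e j p), 0)"
  by (auto simp: upd_s_def coord_s_def prod_eq_iff vec_eq_iff axis_def)

lemma linear_axis_Pair: "linear (\<lambda>h::complex. (axis i h :: complex^'n, 0::complex))"
  by (rule linearI) (simp_all add: prod_eq_iff vec_eq_iff axis_def)

text \<open>Complex linearity of the total derivative turns its restriction to a coordinate line
  into multiplication by a complex number. The derivative is then recovered from these numbers by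
  expansion in the basis labelled by \<open>e\<close>.\<close>

lemma holo_on_partials:
  assumes "holo_on U f" "p \<in> U"
  shows holo_on_partial_s:
      "((\<lambda>z. f (upd_s e j z p)) has_field_derivative partial_s e j f p) (at (coord_s e j p))"
    and holo_on_partial_lam:
      "((\<lambda>z. f (fst p, z)) has_field_derivative partial_lam f p) (at (coord_lam p))"
    and holo_on_derivative:
      "bij_betw e {1..2*K+2} UNIV \<Longrightarrow> (f has_derivative
        (\<lambda>h. (\<Sum>j=1..2*K+2. partial_s e j f p * fst h $ e j) + partial_lam f p * snd h)) (at p)"
proof -
  obtain D where D: "(f has_derivative D) (at p)" and hom: "\<And>c v w. D (c *s v, c * w) = c * D (v, w)"
    using assms unfolding holo_on_def by blast
  have slice_s: "((\<lambda>z. f (upd_s e j z p)) has_field_derivative D (axis (e j) 1, 0)) (at (coord_s e j p))"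
    for j
  proof -
    have "((\<lambda>z. upd_s e j z p) has_derivative (\<lambda>h. (axis (e j) h, 0))) (at (coord_s e j p))"
    proof -
      have "bounded_linear (\<lambda>h::complex. (axis (e j) h :: complex^'a, 0::complex))"
        using linear_axis_Pair by (simp add: linear_conv_bounded_linear)
      moreover have "((\<lambda>z. z - coord_s e j p) has_derivative (\<lambda>h. h)) (at (coord_s e j p))"
        by (auto intro!: derivative_eq_intros)
      ultimately have "((\<lambda>z. (axis (e j) (z - coord_s e j p) :: complex^'a, 0::complex)) has_derivative
        (\<lambda>h. (axis (e j) h, 0))) (at (coord_s e j p))"
        by (rule bounded_linear.has_derivative)
      from has_derivative_add[OF has_derivative_const[of p] this] show ?thesis
        unfolding upd_s_eq by simp
    qed
    from has_derivative_compose[OF this, of f D] D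
    have "((\<lambda>z. f (upd_s e j z p)) has_derivative (\<lambda>h. D (axis (e j) h, 0))) (at (coord_s e j p))"
      by simp
    moreover have "(\<lambda>h. D (axis (e j) h, 0)) = (*) (D (axis (e j) 1, 0))"
    proof
      fix h :: complex
      have "h *s axis (e j) 1 = axis (e j) h"
        by (simp add: vec_eq_iff axis_def)
      then show "D (axis (e j) h, 0) = D (axis (e j) 1, 0) * h"
        using hom[of h "axis (e j) 1" 0] by (simp add: mult.commute)
    qed
    ultimately show ?thesis
      unfolding has_field_derivative_def by (rule has_derivative_eq_rhs)
  qed
  then have s: "partial_s e j f p = D (axis (e j) 1, 0)" for j
    unfolding partial_s_upd by (rule DERIV_imp_deriv)
  show "((\<lambda>z. f (upd_s e j z p)) has_field_derivative partial_s e j f p) (at (coord_s e j p))"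
    unfolding s by (rule slice_s)
  have slice_lam: "((\<lambda>z. f (fst p, z)) has_field_derivative D (0, 1)) (at (coord_lam p))"
  proof -
    have "((\<lambda>z. (fst p, z)) has_derivative (\<lambda>h. (0, h))) (at (coord_lam p))"
      by (intro has_derivative_Pair has_derivative_const has_derivative_ident)
    from has_derivative_compose[OF this, of f D] D
    have "((\<lambda>z. f (fst p, z)) has_derivative (\<lambda>h. D (0, h))) (at (coord_lam p))"
      by (simp add: coord_lam_def)
    moreover have "(\<lambda>h. D (0, h)) = (*) (D (0, 1))"
    proof
      fix h :: complex
      show "D (0, h) = D (0, 1) * h"
        using hom[of h 0 1] by (simp add: mult.commute)
    qed
    ultimately show ?thesis
      unfolding has_field_derivative_def by (rule has_derivative_eq_rhs)
  qed
  then have lam: "partial_lam f p = D (0, 1)"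
    unfolding partial_lam_def by (rule DERIV_imp_deriv)
  show "((\<lambda>z. f (fst p, z)) has_field_derivative partial_lam f p) (at (coord_lam p))"
    unfolding lam by (rule slice_lam)
  assume bij: "bij_betw e {1..2*K+2} UNIV"
  have D_eq: "D h = (\<Sum>j=1..2*K+2. partial_s e j f p * fst h $ e j) + partial_lam f p * snd h" for h
  proof -
    interpret D: linear D
      using D has_derivative_linear by blast
    \<comment> \<open>The redundant products with \<open>0\<close> and \<open>1\<close> give every
      summand the shape \<open>(c *s v, c * w)\<close> of the homogeneity rule.\<close>
    have "h = (\<Sum>i\<in>UNIV. (fst h $ i *s axis i 1, fst h $ i * 0)) + (snd h *s 0, snd h * 1)"
      by (simp add: prod_eq_iff fst_sum snd_sum basis_expansion)
    then have "D h = D ((\<Sum>i\<in>UNIV. (fst h $ i *s axis i 1, fst h $ i * 0)) + (snd h *s 0, snd h * 1))"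
      by (rule arg_cong)
    also have "\<dots> = (\<Sum>i\<in>UNIV. D (fst h $ i *s axis i 1, fst h $ i * 0)) + D (snd h *s 0, snd h * 1)"
      by (simp only: D.add D.sum)
    also have "\<dots> = (\<Sum>i\<in>UNIV. fst h $ i * D (axis i 1, 0)) + snd h * D (0, 1)"
      by (simp only: hom)
    also have "(\<Sum>i\<in>UNIV. fst h $ i * D (axis i 1, 0)) = (\<Sum>j=1..2*K+2. fst h $ e j * D (axis (e j) 1, 0))"
      by (rule sum.reindex_bij_betw[OF bij, symmetric])
    finally show ?thesis
      by (simp add: s lam mult.commute)
  qed
  show "(f has_derivative
        (\<lambda>h. (\<Sum>j=1..2*K+2. partial_s e j f p * fst h $ e j) + partial_lam f p * snd h)) (at p)"
    by (rule has_derivative_eq_rhs[OF D ext[OF D_eq]])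
qed

lemma partial_add:
  assumes "holo_on U f" "holo_on U g" "p \<in> U"
  shows "partial_s e j (\<lambda>q. f q + g q) p = partial_s e j f p + partial_s e j g p"
    and "partial_lam (\<lambda>q. f q + g q) p = partial_lam f p + partial_lam g p"
  using holo_on_partial_s[OF assms(1,3), of e j] holo_on_partial_s[OF assms(2,3), of e j]
    holo_on_partial_lam[OF assms(1,3)] holo_on_partial_lam[OF assms(2,3)]
  unfolding partial_s_upd[of _ _ "\<lambda>q. f q + g q"] partial_lam_def[of "\<lambda>q. f q + g q"]
  by (auto intro!: DERIV_imp_deriv derivative_eq_intros)

lemma partial_mult:
  assumes "holo_on U f" "holo_on U g" "p \<in> U"
  shows "partial_s e j (\<lambda>q. f q * g q) p = partial_s e j f p * g p + f p * partial_s e j g p"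
    and "partial_lam (\<lambda>q. f q * g q) p = partial_lam f p * g p + f p * partial_lam g p"
  using holo_on_partial_s[OF assms(1,3), of e j] holo_on_partial_s[OF assms(2,3), of e j]
    holo_on_partial_lam[OF assms(1,3)] holo_on_partial_lam[OF assms(2,3)]
  unfolding partial_s_upd[of _ _ "\<lambda>q. f q * g q"] partial_lam_def[of "\<lambda>q. f q * g q"]
  by (auto intro!: DERIV_imp_deriv derivative_eq_intros simp: coord_lam_def)

lemma partial_const [simp]:
  "partial_s e j (\<lambda>q. c) p = 0" "partial_lam (\<lambda>q. c) p = 0"
  by (simp_all add: partial_s_def partial_lam_def)

text \<open>A line in an \<open>s\<close>-direction stays in \<open>phase_space\<close>. A line in
  the \<open>\<lambda>\<close>-direction leaves it at \<open>0\<close>, so there only equality near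
  the base point is available.\<close>

lemma partial_cong:
  assumes "\<And>q. q \<in> phase_space \<Longrightarrow> f q = g q" "p \<in> phase_space"
  shows "partial_s e j f p = partial_s e j g p" "partial_lam f p = partial_lam g p"
proof -
  show "partial_s e j f p = partial_s e j g p"
    using assms by (simp add: partial_s_def phase_space_def)
  have "\<forall>\<^sub>F z in nhds (coord_lam p). z \<in> - {0}"
    using assms(2) by (intro eventually_nhds_in_open) (auto simp: phase_space_def coord_lam_def)
  then have "\<forall>\<^sub>F z in nhds (coord_lam p). f (fst p, z) = g (fst p, z)"
    by eventually_elim (use assms(1) in \<open>auto simp: phase_space_def\<close>)
  then show "partial_lam f p = partial_lam g p"
    unfolding partial_lam_def by (intro deriv_cong_ev) auto
qed

lemma holo_on_regular: "f \<in> regular_functions \<Longrightarrow> holo_on phase_space f"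
proof (induction rule: regular_functions.induct)
  case (const c)
  show ?case
    unfolding holo_on_def by (intro ballI exI[of _ "\<lambda>_. 0"]) auto
next
  case (coord i)
  show ?case
    unfolding holo_on_def by (intro ballI exI[of _ "\<lambda>h. fst h $ i"])
      (auto intro!: derivative_eq_intros bounded_linear.has_derivative[OF bounded_linear_vec_nth])
next
  case lam
  show ?case
    unfolding holo_on_def coord_lam_def by (intro ballI exI[of _ "snd"])
      (auto intro!: derivative_eq_intros)
next
  case lam_inv
  show ?case
    unfolding holo_on_def
  proof
    fix p :: "'a phase" assume "p \<in> phase_space"
    then have "((\<lambda>p. inverse (coord_lam p)) has_derivative
        (\<lambda>h. - (inverse (snd p) * snd h * inverse (snd p)))) (at p)"
      unfolding coord_lam_def by (auto simp: phase_space_def intro!: derivative_eq_intros)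
    then show "\<exists>D. ((\<lambda>p. inverse (coord_lam p)) has_derivative D) (at p) \<and>
         (\<forall>c v w. D (c *s v, c * w) = c * D (v, w))"
      by (intro exI conjI) auto
  qed
next
  case (add f g)
  show ?case
    unfolding holo_on_def
  proof
    fix p :: "'a phase" assume "p \<in> phase_space"
    then obtain D E where *: "(f has_derivative D) (at p)" "\<forall>c v w. D (c *s v, c * w) = c * D (v, w)"
      "(g has_derivative E) (at p)" "\<forall>c v w. E (c *s v, c * w) = c * E (v, w)"
      using add.IH unfolding holo_on_def by meson
    then show "\<exists>D. ((\<lambda>p. f p + g p) has_derivative D) (at p) \<and>
         (\<forall>c v w. D (c *s v, c * w) = c * D (v, w))"
      using has_derivative_add[OF *(1,3)]
      by (intro exI[of _ "\<lambda>h. D h + E h"]) (auto simp: algebra_simps)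
  qed
next
  case (mult f g)
  show ?case
    unfolding holo_on_def
  proof
    fix p :: "'a phase" assume "p \<in> phase_space"
    then obtain D E where *: "(f has_derivative D) (at p)" "\<forall>c v w. D (c *s v, c * w) = c * D (v, w)"
      "(g has_derivative E) (at p)" "\<forall>c v w. E (c *s v, c * w) = c * E (v, w)"
      using mult.IH unfolding holo_on_def by meson
    then show "\<exists>D. ((\<lambda>p. f p * g p) has_derivative D) (at p) \<and>
         (\<forall>c v w. D (c *s v, c * w) = c * D (v, w))"
      using has_derivative_mult[OF *(1,3)]
      by (intro exI[of _ "\<lambda>h. f p * E h + D h * g p"]) (auto simp: algebra_simps)
  qed
next
  case (cong f g)
  show ?case
    unfolding holo_on_def
  proof
    fix p :: "'a phase" assume p: "p \<in> phase_space"
    then obtain D where *: "(f has_derivative D) (at p)" "\<forall>c v w. D (c *s v, c * w) = c * D (v, w)"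
      using cong.IH unfolding holo_on_def by meson
    from has_derivative_transform_within_open[OF *(1) open_phase_space p, of g] cong.hyps(2) *(2)
    show "\<exists>D. (g has_derivative D) (at p) \<and> (\<forall>c v w. D (c *s v, c * w) = c * D (v, w))"
      by fastforce
  qed
qed

section \<open>Closure properties of the regular functions\<close>

lemma regular_coord_s: "coord_s e j \<in> regular_functions"
  unfolding coord_s_def[abs_def] by (rule regular_functions.coord)

lemma regular_signed_s: "(\<lambda>p. signed_s e p j) \<in> regular_functions"
  unfolding signed_s_def
  by (rule regular_functions.mult[OF regular_functions.const regular_coord_s])

lemma regular_uminus: "f \<in> regular_functions \<Longrightarrow> (\<lambda>p. - f p) \<in> regular_functions"
  using regular_functions.mult[OF regular_functions.const[of "-1"], of f] by simp

lemma regular_diff: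
  "f \<in> regular_functions \<Longrightarrow> g \<in> regular_functions \<Longrightarrow> (\<lambda>p. f p - g p) \<in> regular_functions"
  using regular_functions.add[OF _ regular_uminus[of g]] by simp

lemma regular_sum:
  "(\<And>i. i \<in> I \<Longrightarrow> f i \<in> regular_functions) \<Longrightarrow> (\<lambda>p. \<Sum>i\<in>I. f i p) \<in> regular_functions"
  by (induction I rule: infinite_finite_induct)
    (auto intro: regular_functions.const regular_functions.add)

lemmas regular_intros = regular_functions.const regular_functions.lam regular_functions.lam_inv
  regular_functions.add regular_functions.mult regular_coord_s regular_uminus regular_diff regular_sum

text \<open>Makes brackets of regular functions regular. The sum and product rules hold on
  \<open>phase_space\<close>, and the last rule of the inductive definition ignores the values
  elsewhere.\<close>

lemma regular_partials:
  "f \<in> regular_functions \<Longrightarrow> partial_s e j f \<in> regular_functions \<and> partial_lam f \<in> regular_functions"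
proof (induction rule: regular_functions.induct)
  case (const c)
  have "partial_s e j (\<lambda>_. c) = (\<lambda>_. 0)" "partial_lam (\<lambda>_ :: 'a phase. c) = (\<lambda>_. 0)"
    by (simp_all add: fun_eq_iff)
  then show ?case
    by (simp add: regular_functions.const)
next
  case (coord i)
  have "partial_s e j (\<lambda>p. fst p $ i) = (\<lambda>_. of_bool (i = e j))" "partial_lam (\<lambda>p :: 'a phase. fst p $ i) = (\<lambda>_. 0)"
    by (simp_all add: partial_s_def partial_lam_def fun_eq_iff)
  then show ?case
    by (simp add: regular_functions.const)
next
  case lam
  have "partial_s e j coord_lam = (\<lambda>_. 0)" "partial_lam (coord_lam :: 'a phase \<Rightarrow> _) = (\<lambda>_. 1)"
    by (simp_all add: partial_simps fun_eq_iff)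
  then show ?case
    by (simp add: regular_functions.const)
next
  case lam_inv
  have "partial_s e j (\<lambda>p. inverse (coord_lam p)) = (\<lambda>_. 0)"
    by (simp add: partial_s_upd fun_eq_iff)
  moreover have "partial_lam (\<lambda>p. inverse (coord_lam p)) p = - (inverse (coord_lam p) * inverse (coord_lam p))"
    if "p \<in> phase_space" for p :: "'a phase"
    unfolding partial_lam_def using that
    by (auto intro!: DERIV_imp_deriv derivative_eq_intros
        simp: coord_lam_def phase_space_def power2_eq_square divide_inverse)
  then have "partial_lam (\<lambda>p :: 'a phase. inverse (coord_lam p)) \<in> regular_functions"
    by (rule regular_functions.cong[rotated]) (assumption | intro regular_intros)+
  ultimately show ?case
    by (simp add: regular_functions.const)
next
  case (add f g)
  then have fg: "holo_on phase_space f" "holo_on phase_space g"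
    by (auto intro: holo_on_regular)
  have "(\<lambda>p. partial_s e j f p + partial_s e j g p) \<in> regular_functions"
    "(\<lambda>p. partial_lam f p + partial_lam g p) \<in> regular_functions"
    using add.IH by (auto intro: regular_functions.add)
  then show ?case
    by (intro conjI) (erule regular_functions.cong, rule partial_add[OF fg], assumption)+
next
  case (mult f g)
  then have fg: "holo_on phase_space f" "holo_on phase_space g"
    by (auto intro: holo_on_regular)
  have "(\<lambda>p. partial_s e j f p * g p + f p * partial_s e j g p) \<in> regular_functions"
    "(\<lambda>p. partial_lam f p * g p + f p * partial_lam g p) \<in> regular_functions"
    using mult by (auto intro: regular_functions.add regular_functions.mult)
  then show ?case
    by (intro conjI) (erule regular_functions.cong, rule partial_mult[OF fg], assumption)+
next
  case (cong f g)
  show ?case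
    by (intro conjI regular_functions.cong[OF conjunct1[OF cong.IH]]
        regular_functions.cong[OF conjunct2[OF cong.IH]] partial_cong[OF cong.hyps(2)])
qed

lemma regular_fn_ss: "fn_ss K e j l \<in> regular_functions"
proof -
  have "(\<lambda>p. of_bool (j + 1 = l) - of_bool (j = 1 \<and> l = 2*K+2) * (inverse (coord_lam p) * inverse (coord_lam p))
     + (-1) powi (int j - int l + 1) * coord_s e j p * coord_s e l p) \<in> regular_functions" for j l
    by (intro regular_intros)
  then have "fn_ss_upper K e j l \<in> regular_functions" for j l
    by (simp add: fn_ss_upper_def[abs_def] divide_inverse power2_eq_square)
  then show ?thesis
    unfolding fn_ss_def[abs_def] by (cases "j < l"; cases "l < j") (auto intro: regular_intros)
qed

lemma regular_bracket:
  assumes "f \<in> regular_functions" "g \<in> regular_functions"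
  shows "fn_bracket K e f g \<in> regular_functions"
  unfolding fn_bracket_def[abs_def] fn_slam_def
  by (intro regular_intros regular_fn_ss) (use assms regular_partials in blast)+

lemma regular_F_mat: "(\<lambda>p. F_mat K e p $ a $ b) \<in> regular_functions"
proof -
  have mat22: "(\<lambda>p. mat22 (f p) (g p) (h p) (k p) $ a $ b) \<in> regular_functions"
    if "f \<in> regular_functions" "g \<in> regular_functions" "h \<in> regular_functions" "k \<in> regular_functions"
    for f g h k :: "'a phase \<Rightarrow> complex" and a b
    using that exhaust_2[of a] exhaust_2[of b] by auto
  have "(\<lambda>p. F_factor e p j $ a $ b) \<in> regular_functions" for j a b
    unfolding F_factor_def by (cases "odd j") (simp_all, (intro mat22 regular_intros)+)
  then have "(\<lambda>p. foldr (**) (map (F_factor e p) xs) (mat22 (coord_lam p) 0 0 (inverse (coord_lam p))) $ a $ b)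
    \<in> regular_functions" for xs
    by (induction xs arbitrary: a b) (auto simp: matrix_mult_entry intro!: regular_intros mat22)
  then show ?thesis
    unfolding F_mat_def .
qed

section \<open>The Poisson ideal generated by the entries of F - 1\<close>

lemma fn_bracket_cong:
  assumes "\<And>q. q \<in> phase_space \<Longrightarrow> f q = g q" "p \<in> phase_space"
  shows "fn_bracket K e f h p = fn_bracket K e g h p"
  unfolding fn_bracket_def using partial_cong[OF assms] by simp

section \<open>Arithmetic in the ideal\<close>

lemma regular_ideal_zero: "(\<lambda>p. 0) \<in> regular_ideal G"
  unfolding regular_ideal_def by (auto intro!: exI[of _ "\<lambda>_ _. 0"] regular_functions.const)

lemma regular_ideal_cong:
  "f \<in> regular_ideal G \<Longrightarrow> (\<And>p. p \<in> phase_space \<Longrightarrow> g p = f p) \<Longrightarrow> g \<in> regular_ideal G"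
  unfolding regular_ideal_def by auto

lemma regular_ideal_add:
  assumes "f \<in> regular_ideal G" "g \<in> regular_ideal G"
  shows "(\<lambda>p. f p + g p) \<in> regular_ideal G"
proof -
  obtain h k where "\<forall>g\<in>G. h g \<in> regular_functions" "\<forall>p\<in>phase_space. f p = (\<Sum>g\<in>G. h g p * g p)"
    "\<forall>g\<in>G. k g \<in> regular_functions" "\<forall>p\<in>phase_space. g p = (\<Sum>g\<in>G. k g p * g p)"
    using assms unfolding regular_ideal_def by auto
  then show ?thesis
    unfolding regular_ideal_def
    by (auto intro!: exI[of _ "\<lambda>g p. h g p + k g p"] regular_functions.add
        simp: distrib_right sum.distrib)
qed

lemma regular_ideal_mult:
  assumes "f \<in> regular_functions" "g \<in> regular_ideal G"
  shows "(\<lambda>p. f p * g p) \<in> regular_ideal G"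
proof -
  obtain h where "\<forall>g\<in>G. h g \<in> regular_functions" "\<forall>p\<in>phase_space. g p = (\<Sum>g\<in>G. h g p * g p)"
    using assms unfolding regular_ideal_def by auto
  then show ?thesis
    unfolding regular_ideal_def using assms(1)
    by (auto intro!: exI[of _ "\<lambda>g p. f p * h g p"] regular_functions.mult
        simp: sum_distrib_left mult.assoc)
qed

lemma regular_ideal_uminus: "f \<in> regular_ideal G \<Longrightarrow> (\<lambda>p. - f p) \<in> regular_ideal G"
  using regular_ideal_mult[OF regular_functions.const[of "-1"], of f] by simp

lemma regular_ideal_sum:
  "(\<And>i. i \<in> I \<Longrightarrow> f i \<in> regular_ideal G) \<Longrightarrow> (\<lambda>p. \<Sum>i\<in>I. f i p) \<in> regular_ideal G"
  by (induction I rule: infinite_finite_induct)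
    (auto intro: regular_ideal_zero regular_ideal_add)

lemma regular_ideal_generator:
  assumes "finite G" "g \<in> G"
  shows "g \<in> regular_ideal G"
proof -
  have "g p = (\<Sum>k\<in>G. of_bool (k = g) * k p)" for p
    using assms by (simp add: of_bool_def if_distrib[of "\<lambda>x. x * _"] cong: if_cong)
  then show ?thesis
    unfolding regular_ideal_def
    by (auto intro!: exI[of _ "\<lambda>k p. of_bool (k = g)"] regular_functions.const)
qed

lemma fn_bracket_Leibniz:
  assumes "inj_on e {1..2*K+2}" "holo_on U f" "holo_on U g" "p \<in> U"
  shows "fn_bracket K e (\<lambda>q. f q * g q) h p = f p * fn_bracket K e g h p + g p * fn_bracket K e f h p"
    and "fn_bracket K e (\<lambda>q. f q + g q) h p = fn_bracket K e f h p + fn_bracket K e g h p"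
  unfolding fn_bracket_expand[OF assms(1), of "\<lambda>q. f q * g q"] fn_bracket_expand[OF assms(1), of "\<lambda>q. f q + g q"]
    fn_bracket_expand[OF assms(1), of f] fn_bracket_expand[OF assms(1), of g]
    partial_add[OF assms(2-4)] partial_mult[OF assms(2-4)]
  by (simp_all add: algebra_simps sum.distrib sum_distrib_left)

text \<open>By the Leibniz rule the bracket of \<open>k g\<close> with \<open>h\<close> is
  \<open>k\<close> times that of \<open>g\<close> plus \<open>g\<close> times that of
  \<open>k\<close>. So closure has to be checked on generators only.\<close>

lemma regular_ideal_bracket_closed:
  assumes inj: "inj_on e {1..2*K+2}" and G: "finite G" "G \<subseteq> regular_functions"
    and gen: "\<And>g. g \<in> G \<Longrightarrow> fn_bracket K e g h \<in> regular_ideal G"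
    and f: "f \<in> regular_ideal G" and h: "h \<in> regular_functions"
  shows "fn_bracket K e f h \<in> regular_ideal G"
proof -
  obtain k where k: "\<forall>g\<in>G. k g \<in> regular_functions" and fk: "\<forall>p\<in>phase_space. f p = (\<Sum>g\<in>G. k g p * g p)"
    using f unfolding regular_ideal_def by auto
  \<comment> \<open>The induction shortens the sum while the ideal remains that of the full set
    \<open>G\<close>.\<close>
  have "fn_bracket K e (\<lambda>p. \<Sum>g\<in>G'. k g p * g p) h \<in> regular_ideal G" if "G' \<subseteq> G" for G'
    using finite_subset[OF that G(1)] that
  proof (induction G' rule: finite_induct)
    case empty
    have "fn_bracket K e (\<lambda>p. 0) h = (\<lambda>p. 0)"
      by (simp add: fn_bracket_def fun_eq_iff)
    then show ?case
      by (simp add: regular_ideal_zero)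
  next
    case (insert g G')
    then have reg: "k g \<in> regular_functions" "g \<in> regular_functions" "g \<in> G"
      "(\<lambda>p. \<Sum>g\<in>G'. k g p * g p) \<in> regular_functions"
      using k G by (auto intro!: regular_sum regular_functions.mult)
    have "(\<lambda>p. (k g p * fn_bracket K e g h p + fn_bracket K e (k g) h p * g p)
        + fn_bracket K e (\<lambda>p. \<Sum>g\<in>G'. k g p * g p) h p) \<in> regular_ideal G"
    proof (intro regular_ideal_add)
      show "(\<lambda>p. k g p * fn_bracket K e g h p) \<in> regular_ideal G"
        using reg by (intro regular_ideal_mult gen)
      show "(\<lambda>p. fn_bracket K e (k g) h p * g p) \<in> regular_ideal G"
        using reg by (intro regular_ideal_mult regular_bracket h regular_ideal_generator G(1))
      show "(\<lambda>p. fn_bracket K e (\<lambda>p. \<Sum>g\<in>G'. k g p * g p) h p) \<in> regular_ideal G"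
        using insert by simp
    qed
    then show ?case
    proof (rule regular_ideal_cong)
      fix p :: "'a phase" assume p: "p \<in> phase_space"
      have "fn_bracket K e (\<lambda>p. k g p * g p + (\<Sum>g\<in>G'. k g p * g p)) h p
        = fn_bracket K e (\<lambda>p. k g p * g p) h p + fn_bracket K e (\<lambda>p. \<Sum>g\<in>G'. k g p * g p) h p"
        using reg by (intro fn_bracket_Leibniz(2)[OF inj _ _ p] holo_on_regular regular_functions.mult)
      also have "fn_bracket K e (\<lambda>p. k g p * g p) h p = k g p * fn_bracket K e g h p + g p * fn_bracket K e (k g) h p"
        using reg by (intro fn_bracket_Leibniz(1)[OF inj _ _ p] holo_on_regular)
      finally show "fn_bracket K e (\<lambda>p. \<Sum>g\<in>insert g G'. k g p * g p) h p =
        (k g p * fn_bracket K e g h p + fn_bracket K e (k g) h p * g p)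
          + fn_bracket K e (\<lambda>p. \<Sum>g\<in>G'. k g p * g p) h p"
        using insert.hyps by (simp add: mult.commute)
    qed
  qed
  from this[OF subset_refl] show ?thesis
    by (rule regular_ideal_cong) (use fk in \<open>auto intro: fn_bracket_cong\<close>)
qed

lemma F_entries_image: "F_entries K e = (\<lambda>(a, b) p. (F_mat K e p - mat 1) $ a $ b) ` UNIV"
  by (auto simp: F_entries_def)

lemma finite_F_entries: "finite (F_entries K e)"
  by (simp add: F_entries_image)

lemma F_entries_regular: "F_entries K e \<subseteq> regular_functions"
  by (auto simp: F_entries_def intro!: regular_diff regular_F_mat regular_functions.const)

text \<open>The identity commutes with \<open>A\<close>, so \<open>F\<close> may be replaced by
  \<open>F - 1\<close>; the entries are then constant combinations of the generators.\<close>

lemma commutator_in_ideal: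
  "(\<lambda>p. commutator A (F_mat K e p) $ a $ b) \<in> regular_ideal (F_entries K e)"
proof -
  have F: "(\<lambda>p. (F_mat K e p - mat 1) $ c $ d) \<in> regular_ideal (F_entries K e)" for c d
    by (rule regular_ideal_generator[OF finite_F_entries]) (auto simp: F_entries_def)
  have "(\<lambda>p. (A $ a $ 1 * (F_mat K e p - mat 1) $ 1 $ b + A $ a $ 2 * (F_mat K e p - mat 1) $ 2 $ b)
    + - (A $ 1 $ b * (F_mat K e p - mat 1) $ a $ 1 + A $ 2 $ b * (F_mat K e p - mat 1) $ a $ 2))
    \<in> regular_ideal (F_entries K e)"
    by (intro regular_ideal_add regular_ideal_uminus regular_ideal_mult F regular_functions.const)
  then show ?thesis
    by (rule regular_ideal_cong) (use exhaust_2[of a] exhaust_2[of b] in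
        \<open>auto simp: commutator_def matrix_mult_entry algebra_simps\<close>)
qed

lemma commutator_swap: "commutator A B $ a $ b = - commutator B A $ a $ b"
  by (simp add: commutator_def)

lemma poisson_subvariety_F:
  assumes "K \<ge> 1" and inj: "inj_on e {1..2*K+2}"
  shows "poisson_subvariety K e (F_entries K e) (S_variety K e)"
proof -
  let ?I = "regular_ideal (F_entries K e)"
  have "fn_bracket K e g h \<in> ?I" if g: "g \<in> F_entries K e" and h: "h \<in> regular_functions" for g h
  proof -
    obtain a b where g_eq: "g = (\<lambda>p. F_mat K e p $ a $ b + - mat 1 $ a $ b)"
      using g by (auto simp: F_entries_def)
    let ?F = "\<lambda>p. F_mat K e p $ a $ b"
    have "(\<lambda>p. - fn_bracket K e h ?F p) \<in> ?I"
    proof (rule regular_ideal_cong)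
      \<comment> \<open>The coordinate brackets of the entry, with
        \<open>1/\<lambda>\<^sup>2\<close> written by inverses to make the coefficients visibly
        regular.\<close>
      let ?s = "\<lambda>j p. (-1/2 * signed_s e p j) * commutator sigma3 (F_mat K e p) $ a $ b
         + of_bool (j = 1) * commutator sigma_minus (F_mat K e p) $ a $ b
         + (of_bool (j = 2*K+2) * (inverse (coord_lam p) * inverse (coord_lam p)))
            * commutator sigma_plus (F_mat K e p) $ a $ b"
      let ?l = "\<lambda>p. coord_lam p * (1/2) * commutator sigma3 (F_mat K e p) $ a $ b"
      show "(\<lambda>p. - ((\<Sum>j=1..2*K+2. partial_s e j h p * ?s j p) + partial_lam h p * ?l p)) \<in> ?I"
      proof -
        have "?s j \<in> ?I" for j
          by (intro regular_ideal_add regular_ideal_mult[OF _ commutator_in_ideal] regular_intros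
              regular_signed_s)
        then have "(\<lambda>p. partial_s e j h p * ?s j p) \<in> ?I" for j
          by (rule regular_ideal_mult[rotated]) (use regular_partials[OF h] in blast)
        moreover have "?l \<in> ?I"
          by (intro regular_ideal_mult[OF _ commutator_in_ideal] regular_intros)
        then have "(\<lambda>p. partial_lam h p * ?l p) \<in> ?I"
          by (rule regular_ideal_mult[rotated]) (use regular_partials[OF h] in blast)
        ultimately show ?thesis
          by (intro regular_ideal_uminus regular_ideal_add regular_ideal_sum)
      qed
      fix p :: "'a phase" assume p: "p \<in> phase_space"
      have "fn_bracket K e (coord_s e j) ?F p = ?s j p" if "j \<in> {1..2*K+2}" for j
        unfolding fn_bracket_s_F[OF inj assms(1) that p] commutator_swap[of "F_mat K e p" sigma3]
        by (simp add: power2_eq_square inverse_eq_divide)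
      moreover have "fn_bracket K e coord_lam ?F p = ?l p"
        unfolding fn_bracket_lam_F[OF inj p] by simp
      ultimately show "- fn_bracket K e h ?F p =
          - ((\<Sum>j=1..2*K+2. partial_s e j h p * ?s j p) + partial_lam h p * ?l p)"
        unfolding fn_bracket_expand[OF inj, of h]
        by (intro arg_cong[where f=uminus] arg_cong2[where f="(+)"] sum.cong refl) simp_all
    qed
    then show ?thesis
    proof (rule regular_ideal_cong)
      fix p :: "'a phase" assume p: "p \<in> phase_space"
      have "fn_bracket K e g h p = fn_bracket K e ?F h p + fn_bracket K e (\<lambda>_. - mat 1 $ a $ b) h p"
        unfolding g_eq
        by (intro fn_bracket_Leibniz(2)[OF inj _ _ p] holo_on_regular regular_F_mat regular_functions.const)
      then show "fn_bracket K e g h p = - fn_bracket K e h ?F p"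
        using fn_bracket_antisym[of K e ?F h p]
        by (simp add: fn_bracket_def[of _ _ "\<lambda>_. - mat 1 $ a $ b"])
    qed
  qed
  then have "\<forall>f\<in>?I. \<forall>h\<in>regular_functions. fn_bracket K e f h \<in> ?I"
    using regular_ideal_bracket_closed[OF inj finite_F_entries F_entries_regular] by blast
  moreover have "S_variety K e = {p \<in> phase_space. \<forall>g\<in>F_entries K e. g p = 0}"
    by (simp add: S_variety_def F_entries_image vec_eq_iff split_paired_all)
  ultimately show ?thesis
    unfolding poisson_subvariety_def by (simp add: finite_F_entries F_entries_regular)
qed

section \<open>The Casimir function\<close>

lemma regular_trace_F: "(\<lambda>p. trace (F_mat K e p)) \<in> regular_functions"
  unfolding trace_22 by (intro regular_functions.add regular_F_mat)

lemma trace_commutator: "commutator A B $ 1 $ 1 + commutator A B $ 2 $ 2 = 0"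
  by (simp add: commutator_def matrix_mult_entry algebra_simps)

lemma det_foldr_F_factor: "det (foldr (**) (map (F_factor e p) xs) M) = det M"
proof (induction xs)
  case (Cons x xs)
  have "det (F_factor e p x) = 1"
    by (simp add: F_factor_def det_2)
  with Cons show ?case
    by (simp add: det_mul)
qed simp

lemma det_F:
  assumes "p \<in> phase_space"
  shows "F_mat K e p $ 1 $ 1 * F_mat K e p $ 2 $ 2 - F_mat K e p $ 1 $ 2 * F_mat K e p $ 2 $ 1 = 1"
proof -
  have "det (F_mat K e p) = 1"
    unfolding F_mat_def det_foldr_F_factor using assms
    by (simp add: det_2 phase_space_def coord_lam_def)
  then show ?thesis
    by (simp add: det_2)
qed

text \<open>The recursion is linear with scalar coefficients, so every linear functional of the
  matrices satisfies it.\<close>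

lemma bracket_chain_trace:
  "bracket_chain (2*K+2) (signed_s e p) (\<lambda>k. trace (Y ** F_deriv K e p k)) (\<lambda>k. trace (Y ** F_diag K e p k))"
  unfolding bracket_chain_def
proof
  fix k assume k: "k \<in> {1..2*K+2}"
  have "F_diag K e p (Suc k) $ a $ b = F_diag K e p k $ a $ b + 2 * signed_s e p k * F_deriv K e p k $ a $ b"
    and "F_deriv K e p (Suc k) $ a $ b = F_deriv K e p (k - 1) $ a $ b
      - signed_s e p k * F_diag K e p k $ a $ b - (signed_s e p k)\<^sup>2 * F_deriv K e p k $ a $ b" for a b
    using bracket_chain_F[of K e p a b] k unfolding bracket_chain_def by blast+
  note step = this
  show "trace (Y ** F_diag K e p (Suc k)) = trace (Y ** F_diag K e p k)
      + 2 * signed_s e p k * trace (Y ** F_deriv K e p k) \<and>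
    trace (Y ** F_deriv K e p (Suc k)) = trace (Y ** F_deriv K e p (k - 1))
      - signed_s e p k * trace (Y ** F_diag K e p k) - (signed_s e p k)\<^sup>2 * trace (Y ** F_deriv K e p k)"
    unfolding trace_22 matrix_mult_entry step by (simp add: algebra_simps)
qed

text \<open>The conclusion includes index \<open>k - 1\<close> because the recursion is second order
  in \<open>u\<close>.\<close>

lemma bracket_chain_unique:
  assumes "bracket_chain N w u q" "bracket_chain N w u' q'" "u 0 = u' 0" "u 1 = u' 1" "q 1 = q' 1"
    and "1 \<le> k" "k \<le> Suc N"
  shows "u k = u' k \<and> u (k - 1) = u' (k - 1) \<and> q k = q' k"
  using assms(6,7)
proof (induction k rule: dec_induct)
  case base
  then show ?case using assms by simp
next
  case (step k)
  then show ?case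
    using assms(1,2) by (auto simp: bracket_chain_def)
qed

context
  fixes K :: nat and e :: "nat \<Rightarrow> 'n::finite"
  assumes K: "K \<ge> 1" and inj: "inj_on e {1..2*K+2}"
begin

text \<open>Brackets of the trace with coordinates are combinations of traces of commutators;
  \<open>fn_bracket_expand\<close> carries this over to \<open>g\<close>.\<close>

lemma bracket_trace_F_zero:
  assumes p: "p \<in> phase_space"
  shows "fn_bracket K e (\<lambda>p. trace (F_mat K e p)) g p = 0"
proof -
  let ?F = "\<lambda>a b p. F_mat K e p $ a $ b"
  have "fn_bracket K e (\<lambda>p. trace (F_mat K e p)) g p = fn_bracket K e (?F 1 1) g p + fn_bracket K e (?F 2 2) g p"
    unfolding trace_22 by (intro fn_bracket_Leibniz(2)[OF inj _ _ p] holo_on_regular regular_F_mat)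
  also have "\<dots> = - (fn_bracket K e g (?F 1 1) p + fn_bracket K e g (?F 2 2) p)"
    using fn_bracket_antisym[of K e _ g p] by simp
  also have "fn_bracket K e g (?F 1 1) p + fn_bracket K e g (?F 2 2) p =
    (\<Sum>j=1..2*K+2. partial_s e j g p * (fn_bracket K e (coord_s e j) (?F 1 1) p + fn_bracket K e (coord_s e j) (?F 2 2) p))
     + partial_lam g p * (fn_bracket K e coord_lam (?F 1 1) p + fn_bracket K e coord_lam (?F 2 2) p)"
    unfolding fn_bracket_expand[OF inj, of g] by (simp add: algebra_simps sum.distrib)
  also have "fn_bracket K e coord_lam (?F 1 1) p + fn_bracket K e coord_lam (?F 2 2) p = 0"
    unfolding fn_bracket_lam_F[OF inj p] distrib_left[symmetric] trace_commutator by simp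
  also have "(\<Sum>j=1..2*K+2. partial_s e j g p * (fn_bracket K e (coord_s e j) (?F 1 1) p + fn_bracket K e (coord_s e j) (?F 2 2) p)) = 0"
  proof (intro sum.neutral ballI)
    fix j assume j: "j \<in> {1..2*K+2}"
    have comm: "commutator A B $ 2 $ 2 = - (commutator A B $ 1 $ 1)" for A B
      using trace_commutator[of A B] by (simp add: eq_neg_iff_add_eq_0 add.commute)
    show "partial_s e j g p * (fn_bracket K e (coord_s e j) (?F 1 1) p + fn_bracket K e (coord_s e j) (?F 2 2) p) = 0"
      unfolding fn_bracket_s_F[OF inj K j p] comm by simp
  qed
  finally show ?thesis
    by simp
qed

text \<open>The recursion for the kernel covector is matched with that of \<open>k \<mapsto> tr (Y \<partial>\<^sub>kF)\<close>, where \<open>Y = F\<^sup>-\<^sup>1 X\<close> and the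
  traceless \<open>X\<close> is read off from the initial values.\<close>

lemma poisson_kernel:
  assumes p: "p \<in> phase_space" and F21: "F_mat K e p $ 2 $ 1 \<noteq> 0"
    and ker_s: "\<And>l. l \<in> {1..2*K+2} \<Longrightarrow> (\<Sum>k=1..2*K+2. fn_ss K e l k p * u k) + fn_slam e l p * v = 0"
    and ker_lam: "(\<Sum>k=1..2*K+2. fn_slam e k p * u k) = 0"
  obtains c where "\<And>k. k \<in> {1..2*K+2} \<Longrightarrow> u k = c * trace (F_deriv K e p k)"
    "v = c * (trace (F_mat K e p ** sigma3) / coord_lam p)"
proof -
  let ?N = "2*K+2" and ?w = "signed_s e p" and ?F = "F_mat K e p" and ?\<mu> = "coord_lam p"
  have lam: "?\<mu> \<noteq> 0"
    using p by (simp add: phase_space_def coord_lam_def)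
  define U where "U = wrap K ?\<mu> u"
  \<comment> \<open>The offset \<open>\<lambda> v\<close> absorbs the
    \<open>\<lambda>\<close>-component of \<open>ker_s\<close>. As the full sum vanishes by
    \<open>ker_lam\<close>, \<open>ker_s\<close> becomes exactly the recursion, and both ends of
    \<open>q\<close> agree.\<close>
  define q where "q l = ?\<mu> * v + 2 * (\<Sum>k=1..<l. ?w k * u k)" for l
  have U: "U k = u k" if "k \<in> {1..?N}" for k
    using that by (auto simp: U_def wrap_def)
  have "(\<Sum>k=1..?N. fn_slam e k p * u k) = ?\<mu> * (\<Sum>k=1..?N. ?w k * u k)"
    unfolding sum_distrib_left by (intro sum.cong) (simp_all add: fn_slam_def signed_s_def)
  with ker_lam lam have T: "(\<Sum>k=1..?N. ?w k * u k) = 0"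
    by simp
  have chain: "bracket_chain ?N ?w U q"
    unfolding bracket_chain_def
  proof (intro ballI conjI)
    fix l assume l: "l \<in> {1..?N}"
    then show "q (Suc l) = q l + 2 * ?w l * U l"
      by (simp add: q_def U)
    show "U (Suc l) = U (l - 1) - ?w l * q l - (?w l)\<^sup>2 * U l"
    proof -
      have "fn_slam e l p = ?w l * ?\<mu>"
        by (simp add: fn_slam_def signed_s_def)
      with ker_s[OF l] show ?thesis
        unfolding fn_ss_sum[OF K l] T U[OF l] q_def U_def[symmetric] by algebra
    qed
  qed
  have q_ends: "q 1 = ?\<mu> * v" "q (Suc ?N) = ?\<mu> * v"
    using T by (simp_all add: q_def atLeastLessThanSuc_atLeastAtMost)
  have U_ends: "U ?N = ?\<mu>\<^sup>2 * U 0" "U (Suc ?N) = U 1 / ?\<mu>\<^sup>2"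
    using lam by (simp_all add: U_def wrap_def)
  \<comment> \<open>Chosen so that the traces of \<open>X\<close> against
    \<open>sigma_minus\<close>, \<open>sigma_plus\<close> and \<open>sigma3\<close> are
    \<open>U 0\<close>, \<open>U 1\<close> and \<open>q 1\<close>. Below, \<open>Y\<close> is the
    adjugate of \<open>F\<close> times \<open>X\<close>; the adjugate is the inverse because the
    determinant is 1.\<close>
  define h where "h = ?\<mu> * v / 2"
  define X where "X = mat22 h (U 0) (U 1) (- h)"
  define Y where "Y = mat22 (?F $ 2 $ 2) (- ?F $ 1 $ 2) (- ?F $ 2 $ 1) (?F $ 1 $ 1) ** X"
  note det = det_F[OF p, of K e]
  have FY: "?F ** Y = X"
    unfolding mat_eq_22 Y_def matrix_mult_entry mat22_entries using det
    by (intro conjI; algebra)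
  have init: "U 0 = trace (Y ** F_deriv K e p 0)" "U 1 = trace (Y ** F_deriv K e p 1)"
    "q 1 = trace (Y ** F_diag K e p 1)"
    unfolding F_deriv_ends[OF p] F_diag_ends q_ends trace_mul_sym[of Y] matrix_mul_assoc[symmetric] FY
    by (simp_all add: trace_22 matrix_mult_entry X_def h_def sigma_minus_def sigma_plus_def sigma3_def)
  note final = bracket_chain_unique[OF chain bracket_chain_trace init, of "Suc ?N"]
  have trX: "trace (Y ** ?F) = 0"
    unfolding trace_mul_sym[of Y] FY by (simp add: X_def trace_22)
  \<comment> \<open>At the far end of the chain the same three traces are taken of
    \<open>Y ** ?F\<close>. The relations \<open>U_ends\<close> and \<open>q_ends\<close> say that
    they agree with those of \<open>X\<close>, so \<open>X\<close> commutes with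
    \<open>F\<close>.\<close>
  have "Y ** ?F = X"
  proof -
    have "trace (Y ** mat_scale (?\<mu>\<^sup>2) (?F ** sigma_minus)) = ?\<mu>\<^sup>2 * U 0"
      using final U_ends F_deriv_ends(3)[OF p, of K e] by simp
    then have "?\<mu>\<^sup>2 * (Y ** ?F) $ 1 $ 2 = ?\<mu>\<^sup>2 * U 0"
      by (simp add: trace_22 matrix_mult_entry mat_scale_def sigma_minus_def algebra_simps)
    moreover have "trace (Y ** mat_scale (1 / ?\<mu>\<^sup>2) (?F ** sigma_plus)) = U 1 / ?\<mu>\<^sup>2"
      using final U_ends F_deriv_ends(4)[OF p, of K e] by (simp add: numeral_3_eq_3)
    then have "(1 / ?\<mu>\<^sup>2) * (Y ** ?F) $ 2 $ 1 = (1 / ?\<mu>\<^sup>2) * U 1"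
      by (simp add: trace_22 matrix_mult_entry mat_scale_def sigma_plus_def add_divide_distrib)
    moreover
    have "trace (Y ** (?F ** sigma3)) = ?\<mu> * v"
      using final q_ends F_diag_ends(2)[of K e p] by (simp add: numeral_3_eq_3)
    then have diff: "(Y ** ?F) $ 1 $ 1 - (Y ** ?F) $ 2 $ 2 = ?\<mu> * v"
      by (simp add: trace_22 matrix_mult_entry sigma3_def algebra_simps)
    have neg: "(Y ** ?F) $ 2 $ 2 = - (Y ** ?F) $ 1 $ 1"
      using trX by (simp add: trace_22 add_eq_0_iff)
    moreover have "(Y ** ?F) $ 1 $ 1 = ?\<mu> * v / 2"
      using diff unfolding neg by (simp add: nonzero_eq_divide_eq mult.commute)
    ultimately show ?thesis
      using lam neg by (simp add: mat_eq_22 X_def h_def)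
  qed
  then have "?F ** X = X ** ?F"
    using FY by (metis matrix_mul_assoc)
  then have entries: "(?F ** X) $ 1 $ 1 = (X ** ?F) $ 1 $ 1" "(?F ** X) $ 2 $ 1 = (X ** ?F) $ 2 $ 1"
    by (simp_all only:)
  have comm: "?F $ 1 $ 2 * U 1 = U 0 * ?F $ 2 $ 1" "?F $ 2 $ 1 * (2 * h) = U 1 * (?F $ 1 $ 1 - ?F $ 2 $ 2)"
    using entries unfolding matrix_mult_entry X_def mat22_entries by algebra+
  \<comment> \<open>As \<open>X\<close> is traceless and commutes with \<open>F\<close>, it is a
    multiple of the traceless part of \<open>F\<close>; the lower left entry gives the factor. The
    scalar matrix \<open>c\<close> can then play the role of \<open>Y\<close>.\<close>
  define c where "c = U 1 / ?F $ 2 $ 1"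
  have v: "?\<mu> * v = c * trace (?F ** sigma3)"
    using F21 comm(2) by (simp add: c_def h_def trace_22 matrix_mult_entry sigma3_def field_simps)
  have scale: "trace (mat22 c 0 0 c ** A) = c * trace A" for A
    by (simp add: trace_22 matrix_mult_entry algebra_simps)
  have "U 0 = trace (mat22 c 0 0 c ** F_deriv K e p 0)" "U 1 = trace (mat22 c 0 0 c ** F_deriv K e p 1)"
    "q 1 = trace (mat22 c 0 0 c ** F_diag K e p 1)"
    unfolding scale F_deriv_ends[OF p] F_diag_ends q_ends v using F21 comm(1)
    by (simp_all add: trace_22 matrix_mult_entry sigma_minus_def sigma_plus_def sigma3_def c_def field_simps)
  note unique = bracket_chain_unique[OF chain bracket_chain_trace this]
  show ?thesis
  proof
    show "u k = c * trace (F_deriv K e p k)" if "k \<in> {1..?N}" for k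
      using unique[of k] U[OF that] that by (simp add: scale)
    show "v = c * (trace (F_mat K e p ** sigma3) / ?\<mu>)"
      using v lam by (simp add: field_simps)
  qed
qed

lemma partials_trace_F:
  assumes "p \<in> phase_space"
  shows "k \<in> {1..2*K+2} \<Longrightarrow> partial_s e k (\<lambda>p. trace (F_mat K e p)) p = trace (F_deriv K e p k)"
    and "partial_lam (\<lambda>p. trace (F_mat K e p)) p = trace (F_mat K e p ** sigma3) / coord_lam p"
  unfolding trace_22 partial_add[OF holo_on_regular[OF regular_F_mat] holo_on_regular[OF regular_F_mat] assms]
  by (simp_all add: partial_s_F[OF inj] partial_lam_F[OF inj assms] add_divide_distrib)

lemma holo_on_subset: "holo_on U f \<Longrightarrow> V \<subseteq> U \<Longrightarrow> holo_on V f"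
  unfolding holo_on_def by blast

text \<open>Testing the Casimir property on the coordinate functions yields precisely the equations
  of \<open>poisson_kernel\<close>.\<close>

lemma casimir_partials:
  assumes "U \<subseteq> phase_space" "casimir_on K e U f" "p \<in> U" "F_mat K e p $ 2 $ 1 \<noteq> 0"
  shows "\<exists>c. (\<forall>k\<in>{1..2*K+2}. partial_s e k f p = c * partial_s e k (\<lambda>p. trace (F_mat K e p)) p) \<and>
    partial_lam f p = c * partial_lam (\<lambda>p. trace (F_mat K e p)) p"
proof -
  have p: "p \<in> phase_space"
    using assms by auto
  have zero: "fn_bracket K e g f p = 0" if "g \<in> regular_functions" for g
  proof -
    have "fn_bracket K e f g p = 0"
      using assms holo_on_subset[OF holo_on_regular[OF that]] by (auto simp: casimir_on_def)
    then show ?thesis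
      by (subst fn_bracket_antisym) simp
  qed
  have ker_s: "(\<Sum>k=1..2*K+2. fn_ss K e l k p * partial_s e k f p) + fn_slam e l p * partial_lam f p = 0"
    if "l \<in> {1..2*K+2}" for l
    using zero[OF regular_coord_s] fn_bracket_coord_s[OF inj that, of f p] by simp
  have ker_lam: "(\<Sum>k=1..2*K+2. fn_slam e k p * partial_s e k f p) = 0"
    using zero[OF regular_functions.lam] fn_bracket_coord_lam[OF inj, of f p] by simp
  show ?thesis
  proof (rule poisson_kernel[OF p assms(4) ker_s ker_lam])
    fix c
    assume "\<And>k. k \<in> {1..2*K+2} \<Longrightarrow> partial_s e k f p = c * trace (F_deriv K e p k)"
      and "partial_lam f p = c * (trace (F_mat K e p ** sigma3) / coord_lam p)"
    then show ?thesis
      by (intro exI[of _ c]) (simp_all add: partials_trace_F[OF p])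
  qed
qed

end

section \<open>Functional dependence on the trace\<close>

lemma norm_axis: "norm (axis i x :: complex^'n) = norm x"
proof -
  have "(\<Sum>k\<in>UNIV. (norm ((axis i x :: complex^'n) $ k))\<^sup>2) = (\<Sum>k\<in>UNIV. if k = i then (norm x)\<^sup>2 else 0)"
    by (intro sum.cong) (auto simp: axis_def)
  then show ?thesis
    by (simp add: norm_vec_def L2_set_def)
qed

lemma dist_upd_s: "dist (upd_s e j z p) p = dist z (coord_s e j p)"
  unfolding upd_s_eq by (simp add: dist_norm norm_Pair norm_axis)

lemma dist_coord_s_le: "dist (coord_s e j p) (coord_s e j q) \<le> dist p q"
proof -
  have "dist (coord_s e j p) (coord_s e j q) \<le> dist (fst p) (fst q)"
    unfolding coord_s_def dist_norm using Finite_Cartesian_Product.norm_nth_le[of "fst p - fst q" "e j"] by simp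
  also have "\<dots> \<le> dist p q"
    by (rule dist_fst_le)
  finally show ?thesis .
qed

lemma upd_s_phase_space [simp]: "upd_s e j z p \<in> phase_space \<longleftrightarrow> p \<in> phase_space"
  by (simp add: phase_space_def upd_s_def)

lemma holo_on_differentiable: "holo_on U f \<Longrightarrow> p \<in> U \<Longrightarrow> f differentiable (at p)"
  unfolding holo_on_def differentiable_def by blast

lemma regular_differentiable: "f \<in> regular_functions \<Longrightarrow> p \<in> phase_space \<Longrightarrow> f differentiable (at p)"
  using holo_on_differentiable holo_on_regular by blast

lemma regular_continuous_on: "f \<in> regular_functions \<Longrightarrow> continuous_on phase_space f"
  by (intro continuous_at_imp_continuous_on ballI differentiable_imp_continuous_within regular_differentiable)

lemma open_F21_nonzero: "open {p \<in> phase_space. F_mat K e p $ 2 $ 1 \<noteq> 0}"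
proof -
  have "{p \<in> phase_space. F_mat K e p $ 2 $ 1 \<noteq> 0} = phase_space \<inter> (\<lambda>p. F_mat K e p $ 2 $ 1) -` (- {0})"
    by auto
  then show ?thesis
    using continuous_open_preimage[OF regular_continuous_on[OF regular_F_mat] open_phase_space,
        of "- {0}" K e 2 1] by (simp add: open_Compl)
qed

lemma upd_s_differentiable:
  assumes "f differentiable (at p)"
  shows "(\<lambda>q. upd_s e j (f q) q) differentiable (at p)"
proof -
  have lin: "(\<lambda>h::complex. (axis (e j) h :: complex^'a, 0::complex)) differentiable F" for F
    using linear_axis_Pair by (rule linear_imp_differentiable)
  have "coord_s e j differentiable (at p)"
    unfolding coord_s_def[abs_def]
    by (intro bounded_linear_imp_differentiable bounded_linear_compose[OF bounded_linear_vec_nth bounded_linear_fst])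
  with assms have "(\<lambda>q. f q - coord_s e j q) differentiable (at p)"
    by (rule differentiable_diff)
  from differentiable_compose[OF lin this] show ?thesis
    unfolding upd_s_eq by (intro differentiable_add differentiable_ident)
qed

context
  fixes K :: nat and e :: "nat \<Rightarrow> 'n::finite"
  assumes K: "K \<ge> 1" and inj: "inj_on e {1..2*K+2}"
begin

text \<open>Where the entry vanishes, determinant 1 forces the upper left entry to be nonzero. That
  entry is the slope of the lower left one in \<open>s_2\<close>, so an arbitrarily small change of
  \<open>s_2\<close> suffices.\<close>

lemma F21_dense:
  assumes "open U" "U \<subseteq> phase_space"
  shows "U \<subseteq> closure {p \<in> U. F_mat K e p $ 2 $ 1 \<noteq> 0}"
proof
  fix p assume p: "p \<in> U"
  then have p': "p \<in> phase_space"
    using assms by auto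
  obtain r where r: "r > 0" "ball p r \<subseteq> U"
    by (rule openE[OF assms(1) p])
  show "p \<in> closure {p \<in> U. F_mat K e p $ 2 $ 1 \<noteq> 0}"
  proof (cases "F_mat K e p $ 2 $ 1 = 0")
    case False
    then show ?thesis
      using p by (intro subsetD[OF closure_subset]) simp
  next
    case True
    have F11: "F_mat K e p $ 1 $ 1 \<noteq> 0"
      using det_F[OF p', of K e] True by auto
    let ?u = "\<lambda>k. F_deriv K e p k $ 2 $ 1" and ?q = "\<lambda>k. F_diag K e p k $ 2 $ 1"
    have "?u (Suc 1) = ?u (1 - 1) - signed_s e p 1 * ?q 1 - (signed_s e p 1)\<^sup>2 * ?u 1"
    proof -
      have "1 \<in> {1..2*K+2}" by simp
      then show ?thesis
        using bracket_chain_F[of K e p 2 1] unfolding bracket_chain_def by blast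
    qed
    moreover have "?u 0 = F_mat K e p $ 1 $ 1" "?u 1 = 0" "?q 1 = 0"
      unfolding F_deriv_ends[OF p'] F_diag_ends using True
      by (simp_all add: matrix_mult_entry sigma_minus_def sigma_plus_def sigma3_def)
    ultimately have slope: "F_deriv K e p 2 $ 2 $ 1 \<noteq> 0"
      using F11 by (simp add: numeral_2_eq_2)
    have upd: "F_mat K e (upd_s e 2 z p) $ 2 $ 1 = (z - coord_s e 2 p) * F_deriv K e p 2 $ 2 $ 1" for z
    proof -
      have 2: "2 \<in> {1..2*K+2}"
        by simp
      show ?thesis
        using F_mat_upd[OF inj 2, of z p 2 1] F_mat_upd[OF inj 2, of "coord_s e 2 p" p 2 1] True
        by (simp add: algebra_simps eq_neg_iff_add_eq_0)
    qed
    show ?thesis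
      unfolding closure_approachable
    proof (intro allI impI)
      fix \<epsilon> :: real assume \<epsilon>: "\<epsilon> > 0"
      define \<delta> where "\<delta> = min \<epsilon> r / 2"
      have \<delta>: "\<delta> > 0" "\<delta> < \<epsilon>" "\<delta> < r"
        using \<epsilon> r(1) by (auto simp: \<delta>_def min_def)
      let ?q = "upd_s e 2 (coord_s e 2 p + of_real \<delta>) p"
      have dist: "dist ?q p = \<delta>"
        unfolding dist_upd_s using \<delta> by (simp add: dist_norm)
      then have "?q \<in> U"
        using r(2) \<delta> by (auto simp: dist_commute)
      moreover have "F_mat K e ?q $ 2 $ 1 \<noteq> 0"
        unfolding upd using slope \<delta> by simp
      ultimately show "\<exists>y\<in>{p \<in> U. F_mat K e p $ 2 $ 1 \<noteq> 0}. dist y p < \<epsilon>"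
        using dist \<delta> by (intro bexI[of _ ?q]) auto
    qed
  qed
qed

text \<open>The slope in \<open>s_1\<close> is \<open>sigma_plus ** F\<close>, which has trace
  \<open>F21\<close> and a vanishing lower left entry.\<close>

lemma F_upd_1:
  shows "trace (F_mat K e (upd_s e 1 z p)) = trace (F_mat K e p) + (z - coord_s e 1 p) * F_mat K e p $ 2 $ 1"
    and "F_mat K e (upd_s e 1 z p) $ 2 $ 1 = F_mat K e p $ 2 $ 1"
proof -
  have 1: "1 \<in> {1..2*K+2}"
    by simp
  have deriv: "F_deriv K e p 1 = sigma_plus ** F_mat K e p"
    using F_right_1[of K e p] F_deriv_left[of 1 K e p] by (simp add: sig_def)
  have upd: "F_mat K e (upd_s e 1 z p) $ a $ b = F_mat K e p $ a $ b
      + (z - coord_s e 1 p) * (sigma_plus ** F_mat K e p) $ a $ b" for a b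
    using F_mat_upd[OF inj 1, of z p a b] F_mat_upd[OF inj 1, of "coord_s e 1 p" p a b]
    unfolding deriv by (simp add: algebra_simps)
  show "trace (F_mat K e (upd_s e 1 z p)) = trace (F_mat K e p) + (z - coord_s e 1 p) * F_mat K e p $ 2 $ 1"
    "F_mat K e (upd_s e 1 z p) $ 2 $ 1 = F_mat K e p $ 2 $ 1"
    unfolding trace_22 upd by (simp_all add: matrix_mult_entry sigma_plus_def)
qed

end

text \<open>Since \<open>tr F\<close> is affine in \<open>s\<^sub>1\<close> with slope \<open>F\<^sub>2\<^sub>1\<close>, one can use \<open>tr F\<close> as a coordinate in place of \<open>s\<^sub>1\<close>
  wherever \<open>F\<^sub>2\<^sub>1 \<noteq> 0\<close>.  The map below is the inverse of \<open>p \<mapsto> upd_s e 1 (tr F p) p\<close>.\<close>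

definition from_trace :: "nat \<Rightarrow> (nat \<Rightarrow> 'n::finite) \<Rightarrow> 'n phase \<Rightarrow> 'n phase" where
  "from_trace K e y =
     upd_s e 1 (coord_s e 1 y + (coord_s e 1 y - trace (F_mat K e y)) / F_mat K e y $ 2 $ 1) y"

context
  fixes K :: nat and e :: "nat \<Rightarrow> 'n::finite"
  assumes K: "K \<ge> 1" and bij: "bij_betw e {1..2*K+2} UNIV"
begin

lemma inj_on_labels: "inj_on e {1..2*K+2}"
  using bij by (rule bij_betw_imp_inj_on)

lemma trace_from_trace:
  assumes "F_mat K e y $ 2 $ 1 \<noteq> 0"
  shows "trace (F_mat K e (from_trace K e y)) = coord_s e 1 y"
  unfolding from_trace_def F_upd_1[OF K inj_on_labels] using assms by simp

text \<open>On the \<open>s_1\<close>-line through \<open>p\<close>, \<open>from_trace\<close>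
  solves for the point with trace \<open>c\<close>; for \<open>c\<close> the trace at
  \<open>p\<close> it returns \<open>p\<close>.\<close>

lemma from_trace_upd:
  assumes "F_mat K e p $ 2 $ 1 \<noteq> 0"
  shows "from_trace K e (upd_s e 1 c p) =
    upd_s e 1 (coord_s e 1 p + (c - trace (F_mat K e p)) / F_mat K e p $ 2 $ 1) p"
proof -
  have "c + (c - (trace (F_mat K e p) + (c - coord_s e 1 p) * F_mat K e p $ 2 $ 1)) / F_mat K e p $ 2 $ 1
    = coord_s e 1 p + (c - trace (F_mat K e p)) / F_mat K e p $ 2 $ 1"
    using assms by (simp add: field_simps)
  then show ?thesis
    unfolding from_trace_def F_upd_1[OF K inj_on_labels] upd_s_simps by simp
qed

lemma from_trace_differentiable:
  assumes "y \<in> phase_space" "F_mat K e y $ 2 $ 1 \<noteq> 0"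
  shows "from_trace K e differentiable (at y)"
  unfolding from_trace_def[abs_def] using assms
  by (intro upd_s_differentiable differentiable_add differentiable_divide differentiable_diff
      regular_differentiable regular_coord_s regular_trace_F regular_F_mat)

text \<open>At the image point the differential of \<open>f\<close> is \<open>c\<close> times that
  of the trace, and the trace after \<open>from_trace\<close> is the first coordinate. The chain
  rule combines the two.\<close>

lemma casimir_from_trace_derivative:
  assumes U: "U \<subseteq> phase_space" "casimir_on K e U f"
    and y: "y \<in> phase_space" "F_mat K e y $ 2 $ 1 \<noteq> 0" "from_trace K e y \<in> U"
  obtains c where "((\<lambda>y. f (from_trace K e y)) has_derivative (\<lambda>d. c * coord_s e 1 d)) (at y)"
proof -
  let ?\<Psi> = "from_trace K e" and ?C = "\<lambda>p. trace (F_mat K e p)"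
  define DD where "DD g h = (\<Sum>j=1..2*K+2. partial_s e j g (?\<Psi> y) * fst h $ e j) + partial_lam g (?\<Psi> y) * snd h"
    for g h
  have "F_mat K e (?\<Psi> y) $ 2 $ 1 \<noteq> 0"
    unfolding from_trace_def F_upd_1[OF K inj_on_labels] by (rule y(2))
  from casimir_partials[OF K inj_on_labels U y(3) this]
  obtain c where c: "\<forall>k\<in>{1..2*K+2}. partial_s e k f (?\<Psi> y) = c * partial_s e k ?C (?\<Psi> y)"
    "partial_lam f (?\<Psi> y) = c * partial_lam ?C (?\<Psi> y)"
    by (elim exE conjE)
  have DD: "DD f h = c * DD ?C h" for h
  proof -
    have "(\<Sum>j=1..2*K+2. partial_s e j f (?\<Psi> y) * fst h $ e j)
      = (\<Sum>j=1..2*K+2. c * (partial_s e j ?C (?\<Psi> y) * fst h $ e j))"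
      by (intro sum.cong refl) (simp only: c(1)[rule_format] mult.assoc)
    then show ?thesis
      by (simp add: DD_def c(2) distrib_left mult.assoc flip: sum_distrib_left)
  qed
  obtain D where D: "(?\<Psi> has_derivative D) (at y)"
    using from_trace_differentiable[OF y(1,2)] unfolding differentiable_def by blast
  have f: "(f has_derivative DD f) (at (?\<Psi> y))"
    using U y holo_on_derivative[OF _ y(3) bij, of f] by (auto simp: casimir_on_def DD_def[abs_def])
  have C: "(?C has_derivative DD ?C) (at (?\<Psi> y))"
    using U y holo_on_derivative[OF holo_on_regular[OF regular_trace_F] _ bij, of "?\<Psi> y" K e]
    unfolding DD_def[abs_def] by blast
  have "((\<lambda>y. coord_s e 1 y) has_derivative (\<lambda>h. DD ?C (D h))) (at y)"
    by (rule has_derivative_transform_within_open[OF has_derivative_compose[OF D C] open_F21_nonzero[of K e]])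
      (use y trace_from_trace in auto)
  moreover have "((\<lambda>y. coord_s e 1 y) has_derivative coord_s e 1) (at y)"
    unfolding coord_s_def[abs_def]
    by (auto intro!: derivative_eq_intros bounded_linear.has_derivative[OF bounded_linear_vec_nth])
  ultimately have "(\<lambda>h. DD ?C (D h)) = coord_s e 1"
    by (rule has_derivative_unique)
  then have "DD f (D h) = c * coord_s e 1 h" for h
    unfolding DD by (metis)
  with has_derivative_compose[OF D f] show ?thesis
    by (intro that[of c]) simp
qed

lemma casimir_functionally_dependent:
  assumes U: "open U" "U \<subseteq> phase_space" and f: "casimir_on K e U f"
  shows "functionally_dependent_on U f (\<lambda>p. trace (F_mat K e p))"
proof -
  let ?\<Psi> = "from_trace K e" and ?C = "\<lambda>p. trace (F_mat K e p)" and ?F21 = "\<lambda>p. F_mat K e p $ 2 $ 1"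
  define \<Phi> where "\<Phi> p = upd_s e 1 (?C p) p" for p
  define G where "G = {p \<in> phase_space. ?F21 p \<noteq> 0}"
  define V where "V = {p \<in> U. ?F21 p \<noteq> 0}"
  have G: "open G"
    unfolding G_def by (rule open_F21_nonzero)
  have "V = U \<inter> G"
    using U by (auto simp: V_def G_def)
  then have V: "open V" "V \<subseteq> G" "V \<subseteq> U"
    using U G by auto
  have \<Psi>\<Phi>: "?\<Psi> (\<Phi> q) = q" if "q \<in> G" for q
    using that unfolding \<Phi>_def G_def by (subst from_trace_upd) auto
  have \<Phi>G: "\<Phi> q \<in> G" if "q \<in> G" for q
    using that unfolding \<Phi>_def G_def by (simp add: F_upd_1[OF K inj_on_labels] del: One_nat_def)
  have "continuous_on G ?\<Psi>"
    by (intro continuous_at_imp_continuous_on ballI differentiable_imp_continuous_within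
        from_trace_differentiable) (auto simp: G_def)
  then have N: "open (G \<inter> ?\<Psi> -` V)"
    using G V(1) by (rule continuous_open_preimage)
  have "continuous_on V \<Phi>"
    unfolding \<Phi>_def[abs_def] using V(2) G_def
    by (intro continuous_at_imp_continuous_on ballI differentiable_imp_continuous_within
        upd_s_differentiable regular_differentiable regular_trace_F) auto
  note \<Phi>cont = this
  show ?thesis
    unfolding functionally_dependent_on_def
  proof (rule exI[of _ V], intro conjI ballI)
    show "open V" "V \<subseteq> U" using V by auto
    show "U \<subseteq> closure V"
      unfolding V_def by (rule F21_dense[OF K inj_on_labels U])
    fix p assume p: "p \<in> V"
    then have pO: "p \<in> G" "?F21 p \<noteq> 0"
      using V by (auto simp: G_def)
    have "\<Phi> p \<in> G \<inter> ?\<Psi> -` V"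
      using p pO \<Psi>\<Phi> \<Phi>G by auto
    \<comment> \<open>A ball in the new coordinates: by convexity, two of its points with equal
      first coordinate are joined by a segment on which that coordinate is constant.\<close>
    from openE[OF N this] obtain r where r: "r > 0" "ball (\<Phi> p) r \<subseteq> G \<inter> ?\<Psi> -` V" .
    define W where "W = V \<inter> \<Phi> -` ball (\<Phi> p) r"
    define \<phi> where "\<phi> c = f (?\<Psi> (upd_s e 1 c p))" for c
    have upd_ball: "upd_s e 1 c p \<in> ball (\<Phi> p) r" if "dist c (?C p) < r" for c
    proof -
      have "upd_s e 1 c p = upd_s e 1 c (\<Phi> p)"
        by (simp add: \<Phi>_def)
      then show ?thesis
        using that dist_upd_s[of e 1 c "\<Phi> p"] by (simp add: \<Phi>_def dist_commute)
    qed
    have "open W"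
      unfolding W_def using \<Phi>cont V(1) by (intro continuous_open_preimage) auto
    moreover have "p \<in> W"
      using p r by (simp add: W_def)
    moreover have "W \<subseteq> V"
      by (auto simp: W_def)
    moreover have CW: "?C ` W \<subseteq> ball (?C p) r"
    proof
      fix c assume "c \<in> ?C ` W"
      then obtain q where q: "q \<in> W" "c = ?C q" by auto
      have "dist (coord_s e 1 (\<Phi> p)) (coord_s e 1 (\<Phi> q)) \<le> dist (\<Phi> p) (\<Phi> q)"
        by (rule dist_coord_s_le)
      then show "c \<in> ball (?C p) r"
        using q by (simp add: W_def \<Phi>_def)
    qed
    moreover have "\<phi> holomorphic_on ball (?C p) r"
      unfolding holomorphic_on_def
    proof
      fix c assume "c \<in> ball (?C p) r"
      then have "upd_s e 1 c p \<in> ball (\<Phi> p) r"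
        by (intro upd_ball) (simp add: dist_commute)
      then have inV: "?\<Psi> (upd_s e 1 c p) \<in> U"
        using subsetD[OF r(2)] subsetD[OF V(3)] by blast
      \<comment> \<open>On the line through \<open>p\<close>, \<open>from_trace\<close> is an affine
        change of parameter, so \<open>\<phi>\<close> is a one-variable slice of \<open>f\<close>
        composed with \<open>z\<close>.\<close>
      define z where "z c = coord_s e 1 p + (c - ?C p) / ?F21 p" for c
      have \<Psi>_eq: "?\<Psi> (upd_s e 1 c p) = upd_s e 1 (z c) p" for c
        unfolding z_def using pO(2) by (rule from_trace_upd)
      have "((\<lambda>x. f (upd_s e 1 x (upd_s e 1 (z c) p))) has_field_derivative
          partial_s e 1 f (upd_s e 1 (z c) p)) (at (coord_s e 1 (upd_s e 1 (z c) p)))"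
        using f inV unfolding \<Psi>_eq casimir_on_def by (blast intro: holo_on_partial_s)
      then have "((\<lambda>x. f (upd_s e 1 x p)) has_field_derivative
          partial_s e 1 f (upd_s e 1 (z c) p)) (at (z c))"
        unfolding upd_s_simps .
      moreover have "(z has_field_derivative 1 / ?F21 p) (at c)"
        unfolding z_def using pO(2) by (auto intro!: derivative_eq_intros)
      ultimately have "((\<lambda>c. f (upd_s e 1 (z c) p)) has_field_derivative
          partial_s e 1 f (upd_s e 1 (z c) p) * (1 / ?F21 p)) (at c)"
        by (rule DERIV_chain2)
      then show "\<phi> field_differentiable at c within ball (?C p) r"
        unfolding \<phi>_def[abs_def] \<Psi>_eq field_differentiable_def
        using has_field_derivative_at_within by blast
    qed
    moreover have "f q = \<phi> (?C q)" if q: "q \<in> W" for q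
    proof -
      \<comment> \<open>Both \<open>y\<close> and \<open>y + d\<close> have the trace at
        \<open>q\<close> as first coordinate, hence \<open>from_trace\<close> maps the segment
        between them into a level set of the trace.\<close>
      define y where "y = \<Phi> q"
      define d where "d = upd_s e 1 (?C q) p - y"
      have d1: "coord_s e 1 d = 0"
      proof -
        have "coord_s e 1 d = coord_s e 1 (upd_s e 1 (?C q) p) - coord_s e 1 y"
          by (simp add: d_def coord_s_def)
        then show ?thesis
          by (simp add: y_def \<Phi>_def)
      qed
      have "?C q \<in> ball (?C p) r"
        using CW q by blast
      then have ends: "y \<in> ball (\<Phi> p) r" "y + d \<in> ball (\<Phi> p) r"
        using q upd_ball[of "?C q"] by (simp_all add: y_def W_def d_def dist_commute)
      have seg: "y + t *\<^sub>R d \<in> ball (\<Phi> p) r" if "t \<in> {0..1}" for t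
      proof -
        have "y + t *\<^sub>R d = (1 - t) *\<^sub>R y + t *\<^sub>R (y + d)"
          by (simp add: algebra_simps)
        then show ?thesis
          using convexD_alt[OF convex_ball ends, of t] that by simp
      qed
      have "\<exists>c. \<forall>t\<in>{0..1}. f (?\<Psi> (y + t *\<^sub>R d)) = c"
      proof (rule has_derivative_zero_constant)
        fix t :: real assume "t \<in> {0..1}"
        then have "y + t *\<^sub>R d \<in> G" "?\<Psi> (y + t *\<^sub>R d) \<in> U"
          using subsetD[OF r(2) seg[of t]] subsetD[OF V(3)] by blast+
        then obtain c where "((\<lambda>y. f (?\<Psi> y)) has_derivative (\<lambda>d. c * coord_s e 1 d)) (at (y + t *\<^sub>R d))"
          using casimir_from_trace_derivative[OF U(2) f, of "y + t *\<^sub>R d"] by (auto simp: G_def)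
        moreover have "((\<lambda>t. y + t *\<^sub>R d) has_derivative (\<lambda>h. h *\<^sub>R d)) (at t within {0..1})"
          by (auto intro!: derivative_eq_intros)
        ultimately have "((\<lambda>t. f (?\<Psi> (y + t *\<^sub>R d))) has_derivative (\<lambda>h. c * coord_s e 1 (h *\<^sub>R d)))
            (at t within {0..1})"
          by (rule has_derivative_compose[rotated])
        moreover have "coord_s e 1 (h *\<^sub>R d) = 0" for h
          using d1 by (simp add: coord_s_def)
        ultimately show "((\<lambda>t. f (?\<Psi> (y + t *\<^sub>R d))) has_derivative (\<lambda>h. 0)) (at t within {0..1})"
          by simp
      qed simp
      then obtain c where c: "\<And>t. t \<in> {0..1} \<Longrightarrow> f (?\<Psi> (y + t *\<^sub>R d)) = c"
        by blast
      have "f (?\<Psi> y) = f (?\<Psi> (y + d))"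
        using c[of 0] c[of 1] by simp
      moreover have "?\<Psi> y = q"
        unfolding y_def using q V(2) by (intro \<Psi>\<Phi>) (auto simp: W_def)
      ultimately show ?thesis
        by (simp add: \<phi>_def d_def)
    qed
    ultimately show "\<exists>W D \<phi>. open W \<and> p \<in> W \<and> W \<subseteq> V \<and> open D \<and> ?C ` W \<subseteq> D \<and>
        \<phi> holomorphic_on D \<and> (\<forall>q\<in>W. f q = \<phi> (?C q))"
      by (intro exI[of _ W] exI[of _ "ball (?C p) r"] exI[of _ \<phi>]) simp
  qed
qed

text \<open>Constancy would make the \<open>s_1\<close>-slope \<open>F21\<close> vanish identically,
  against its density statement.\<close>

lemma trace_F_not_constant: "\<not> (\<lambda>p. trace (F_mat K e p)) constant_on phase_space"
proof
  assume "(\<lambda>p. trace (F_mat K e p)) constant_on phase_space"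
  then obtain c where c: "trace (F_mat K e p) = c" if "p \<in> phase_space" for p :: "'n phase"
    unfolding constant_on_def by blast
  have "F_mat K e p $ 2 $ 1 = 0" if p: "p \<in> phase_space" for p
    using F_upd_1(1)[OF K inj_on_labels, of "coord_s e 1 p + 1" p] c[OF p] c[of "upd_s e 1 (coord_s e 1 p + 1) p"] p
    by (simp del: One_nat_def)
  then have "{p \<in> phase_space. F_mat K e p $ 2 $ 1 \<noteq> 0} = {}"
    by blast
  moreover have "(0, 1) \<in> (phase_space :: 'n phase set)"
    by (simp add: phase_space_def)
  ultimately show False
    using F21_dense[OF K inj_on_labels open_phase_space subset_refl] by (metis closure_empty empty_iff subsetD)
qed

end

theorem proposition3p14:
  fixes K :: nat and e :: "nat \<Rightarrow> 'n::finite"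
  assumes "K \<ge> 1"
    and "bij_betw e {1..2*K+2} (UNIV :: 'n set)"
  shows
    "(\<forall>p\<in>phase_space.
        fn_bracket_mat K e (coord_s e 1) (F_mat K e) p
          = mat_scale (coord_s e 1 p / 2) (commutator sigma3 (F_mat K e p))
            + commutator sigma_minus (F_mat K e p)
      \<and> fn_bracket_mat K e (coord_s e (2*K+2)) (F_mat K e) p
          = mat_scale (coord_s e (2*K+2) p / 2) (commutator (F_mat K e p) sigma3)
            + mat_scale (1 / (coord_lam p)\<^sup>2) (commutator sigma_plus (F_mat K e p))
      \<and> (\<forall>l\<in>{2..2*K+1}.
          fn_bracket_mat K e (coord_s e l) (F_mat K e) p
            = mat_scale ((-1) ^ l * (coord_s e l p / 2)) (commutator (F_mat K e p) sigma3))
      \<and> fn_bracket_mat K e coord_lam (F_mat K e) p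
          = mat_scale (coord_lam p / 2) (commutator sigma3 (F_mat K e p)))
   \<and> (casimir_on K e phase_space (\<lambda>p. trace (F_mat K e p))
      \<and> \<not> (\<lambda>p. trace (F_mat K e p)) constant_on phase_space
      \<and> (\<forall>U f. open U \<and> U \<subseteq> phase_space \<and> casimir_on K e U f
           \<longrightarrow> functionally_dependent_on U f (\<lambda>p. trace (F_mat K e p))))
   \<and> poisson_subvariety K e (F_entries K e) (S_variety K e)"
proof (intro conjI ballI)
  note inj = bij_betw_imp_inj_on[OF assms(2)]
  note s = fn_bracket_s_F[OF inj assms(1)]
  fix p :: "'n phase" assume p: "p \<in> phase_space"
  \<comment> \<open>For \<open>l = 1\<close> the sign in \<open>signed_s\<close> reverses the order
    in the \<open>sigma3\<close> commutator.\<close>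
  show "fn_bracket_mat K e (coord_s e 1) (F_mat K e) p
      = mat_scale (coord_s e 1 p / 2) (commutator sigma3 (F_mat K e p)) + commutator sigma_minus (F_mat K e p)"
    using s[OF _ p, of 1] commutator_swap[of "F_mat K e p" sigma3]
    by (simp add: fn_bracket_mat_def mat_scale_def vec_eq_iff signed_s_def)
  show "fn_bracket_mat K e (coord_s e (2*K+2)) (F_mat K e) p
      = mat_scale (coord_s e (2*K+2) p / 2) (commutator (F_mat K e p) sigma3)
        + mat_scale (1 / (coord_lam p)\<^sup>2) (commutator sigma_plus (F_mat K e p))"
    using s[OF _ p, of "2*K+2"]
    by (simp add: fn_bracket_mat_def mat_scale_def vec_eq_iff signed_s_def)
  show "fn_bracket_mat K e (coord_s e l) (F_mat K e) p
      = mat_scale ((-1) ^ l * (coord_s e l p / 2)) (commutator (F_mat K e p) sigma3)"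
    if "l \<in> {2..2*K+1}" for l
    using s[OF _ p, of l] that
    by (simp add: fn_bracket_mat_def mat_scale_def vec_eq_iff signed_s_def)
  show "fn_bracket_mat K e coord_lam (F_mat K e) p
      = mat_scale (coord_lam p / 2) (commutator sigma3 (F_mat K e p))"
    by (simp add: fn_bracket_mat_def mat_scale_def vec_eq_iff fn_bracket_lam_F[OF inj p])
next
  note inj = bij_betw_imp_inj_on[OF assms(2)]
  show "casimir_on K e phase_space (\<lambda>p. trace (F_mat K e p))"
    unfolding casimir_on_def
    using bracket_trace_F_zero[OF assms(1) inj] holo_on_regular[OF regular_trace_F] by blast
  show "\<not> (\<lambda>p. trace (F_mat K e p)) constant_on phase_space"
    by (rule trace_F_not_constant[OF assms])
  show "\<forall>U f. open U \<and> U \<subseteq> phase_space \<and> casimir_on K e U f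
           \<longrightarrow> functionally_dependent_on U f (\<lambda>p. trace (F_mat K e p))"
    using casimir_functionally_dependent[OF assms] by blast
  show "poisson_subvariety K e (F_entries K e) (S_variety K e)"
    by (rule poisson_subvariety_F[OF assms(1) inj])
qed

end
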